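(* Fix $\alpha\ge 0$ and $\beta_1,\beta_2>0$ with $\beta_1\neq\beta_2$. For each large $L$ consider the dynamic stochastic six-vertex model in the positive quadrant with domain wall boundary conditions, with dynamic parameter $\alpha$ and with parameters $b,q$ depending on $L$ through $$b=\exp(-\beta_1/L),\qquad qb=\exp(-\beta_2/L).$$ Set $\mathfrak q=e^{\beta_1-\beta_2}$ (so that $q=\mathfrak q^{1/L}$) and $\mathfrak s=\beta_1/\beta_2$. Let $H$ be the height function. Then for all $x,y>0$, $$\lim_{L\to\infty}\frac1L H(Lx,Ly)=\mathbf h(x,y)\qquad\text{in probability},$$ where $\mathbf h(x,y)$ is the only real (deterministic) solution of $$\frac{\bigl(\mathfrak q^{-\mathbf h(x,y)}\mathfrak q^{y-x}+\alpha^{-1}\bigr)\bigl(\mathfrak q^{\mathbf h(x,y)}-1\bigr)}{1+\alpha^{-1}}=\frac{1}{2\pi \mathbf i}\oint_{-1}\exp\left(\ln(\mathfrak q)\left(-x\frac{\mathfrak s z}{1+\mathfrak s z}+y\frac{z}{1+z}\right)\right)\frac{dz}{z},$$ with integration in the positive direction around the singularity at $-1$, and with the singularities at $0$ and $-1/\mathfrak s$ outside the contour. For $\alpha=0$ the left-hand side of this equation is understood as $\mathfrak q^{\mathbf h(x,y)}-1$.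
   Context: **Dynamic stochastic six-vertex model with domain wall boundary conditions.** Parameters: $q>0$, $0<b<1$ with $bq<1$, and $\alpha\ge0$. Vertices are the points $(x,y)\in\mathbb Z_{\ge1}^2$. A configuration is a collection of up-right lattice paths which may touch at a vertex but do not cross or share edges. Domain wall boundary conditions: for every $y\ge1$ a path enters the vertex $(1,y)$ from the left, and no paths enter from below through the vertices $(x,1)$. The random configuration is built sequentially from the bottom-left corner in the up-right direction. Once it is known which paths enter a vertex $(x,y)$ from the left and from below, the outgoing paths are sampled (independently of everything else given the past) as follows. * No incoming paths: no outgoing paths. * Two incoming paths (left and below): two outgoing paths (right and up). * Exactly one incoming path, from the left: it exits to the right with probability $b\,\dfrac{q^{d}+\alpha q}{q^{d}+\alpha}$ and otherwise turns and exits upwards. * Exactly one incoming path, from below: it exits upwards with probability $b\,\dfrac{q^{d+1}+\alpha}{q^{d}+\alpha}$ and otherwise turns and exits to the right. Here $d=d(x,y)=x-y-1+2H(x,y)$, and $H(x,y)$ is the height function: for $x\ge 1$, $y\ge 0$ integers, $H(x,y)$ is the number of $y'\in\{1,\dots,y\}$ such that a path enters the vertex $(x,y')$ from the left. (For $\alpha=0$ the two straight-path probabilities are $b$ and $bq$.) $H$ is extended to real arguments first linearly in the $x$-direction and then linearly in the $y$-direction. *)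

theory Defs
  imports "HOL-Probability.Probability" "HOL-Complex_Analysis.Complex_Analysis"
begin

section \<open>The dynamic stochastic six-vertex model\<close>

definition straight_from_left :: "real \<Rightarrow> real \<Rightarrow> real \<Rightarrow> int \<Rightarrow> real" where
  "straight_from_left b q \<alpha> d = b * ((q powi d + \<alpha> * q) / (q powi d + \<alpha>))"

definition straight_from_below :: "real \<Rightarrow> real \<Rightarrow> real \<Rightarrow> int \<Rightarrow> real" where
  "straight_from_below b q \<alpha> d = b * ((q powi (d + 1) + \<alpha>) / (q powi d + \<alpha>))"

text \<open>
  The outcome at a single vertex, given whether a path enters from the left (\<open>l\<close>) and from below
  (\<open>v\<close>), the dynamic variable \<open>d\<close>, and a sample \<open>u\<close> that is uniform on \<open>[0,1]\<close>: a lone incoming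
  path goes straight iff \<open>u\<close> is below the corresponding probability.
\<close>

definition exits_right :: "real \<Rightarrow> real \<Rightarrow> real \<Rightarrow> int \<Rightarrow> real \<Rightarrow> bool \<Rightarrow> bool \<Rightarrow> bool" where
  "exits_right b q \<alpha> d u l v \<longleftrightarrow>
     (if l \<and> v then True
      else if l then u < straight_from_left b q \<alpha> d
      else if v then \<not> u < straight_from_below b q \<alpha> d
      else False)"

definition exits_up :: "real \<Rightarrow> real \<Rightarrow> real \<Rightarrow> int \<Rightarrow> real \<Rightarrow> bool \<Rightarrow> bool \<Rightarrow> bool" where
  "exits_up b q \<alpha> d u l v \<longleftrightarrow>
     (if l \<and> v then True
      else if l then \<not> u < straight_from_left b q \<alpha> d
      else if v then u < straight_from_below b q \<alpha> d
      else False)"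

text \<open>
  A configuration of non-crossing paths is encoded by its occupied edges: \<open>enters_left b q \<alpha> \<omega> x y\<close>
  and \<open>enters_below b q \<alpha> \<omega> x y\<close> say that a path enters the vertex \<open>(x,y)\<close>, \<open>x,y \<ge> 1\<close>, from the
  left, respectively from below; \<open>\<omega> (x,y)\<close> is the uniform sample used at that vertex. The sum in
  the recursive calls is the height function. Values with \<open>x = 0\<close> or \<open>y = 0\<close> carry no meaning.
\<close>

function enters_left :: "real \<Rightarrow> real \<Rightarrow> real \<Rightarrow> (nat \<times> nat \<Rightarrow> real) \<Rightarrow> nat \<Rightarrow> nat \<Rightarrow> bool"
  and enters_below :: "real \<Rightarrow> real \<Rightarrow> real \<Rightarrow> (nat \<times> nat \<Rightarrow> real) \<Rightarrow> nat \<Rightarrow> nat \<Rightarrow> bool"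
where
  "enters_left b q \<alpha> \<omega> 0 y = False"
| "enters_left b q \<alpha> \<omega> (Suc 0) y = True"
| "enters_left b q \<alpha> \<omega> (Suc (Suc x)) y =
     exits_right b q \<alpha>
       (int (Suc x) - int y - 1 + 2 * (\<Sum>y'=1..y. of_bool (enters_left b q \<alpha> \<omega> (Suc x) y')))
       (\<omega> (Suc x, y)) (enters_left b q \<alpha> \<omega> (Suc x) y) (enters_below b q \<alpha> \<omega> (Suc x) y)"
| "enters_below b q \<alpha> \<omega> x 0 = False"
| "enters_below b q \<alpha> \<omega> x (Suc 0) = False"
| "enters_below b q \<alpha> \<omega> x (Suc (Suc y)) =
     exits_up b q \<alpha>
       (int x - int (Suc y) - 1 + 2 * (\<Sum>y'=1..Suc y. of_bool (enters_left b q \<alpha> \<omega> x y')))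
       (\<omega> (x, Suc y)) (enters_left b q \<alpha> \<omega> x (Suc y)) (enters_below b q \<alpha> \<omega> x (Suc y))"
  by pat_completeness auto
termination
  by (relation "Wellfounded.measure (\<lambda>p. case p of Inl (_, _, _, _, x, y) \<Rightarrow> x + y | Inr (_, _, _, _, x, y) \<Rightarrow> x + y)")
     auto

definition height :: "real \<Rightarrow> real \<Rightarrow> real \<Rightarrow> (nat \<times> nat \<Rightarrow> real) \<Rightarrow> nat \<Rightarrow> nat \<Rightarrow> nat" where
  "height b q \<alpha> \<omega> x y = card {y' \<in> {1..y}. enters_left b q \<alpha> \<omega> x y'}"

lemma sum_enters_left_eq_height:
  "(\<Sum>y'=1..y. of_bool (enters_left b q \<alpha> \<omega> x y')) = int (height b q \<alpha> \<omega> x y)"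
proof -
  have "{1..y} \<inter> {y'. enters_left b q \<alpha> \<omega> x y'} = {y' \<in> {1..y}. enters_left b q \<alpha> \<omega> x y'}"
    by auto
  then show ?thesis
    by (simp add: height_def)
qed

text \<open>Only arguments \<open>X \<ge> 1\<close>, \<open>Y \<ge> 0\<close> are meaningful.\<close>

definition height_interp_x :: "real \<Rightarrow> real \<Rightarrow> real \<Rightarrow> (nat \<times> nat \<Rightarrow> real) \<Rightarrow> real \<Rightarrow> nat \<Rightarrow> real" where
  "height_interp_x b q \<alpha> \<omega> X n =
     (1 - frac X) * real (height b q \<alpha> \<omega> (nat \<lfloor>X\<rfloor>) n)
     + frac X * real (height b q \<alpha> \<omega> (nat \<lfloor>X\<rfloor> + 1) n)"

definition height_interp :: "real \<Rightarrow> real \<Rightarrow> real \<Rightarrow> (nat \<times> nat \<Rightarrow> real) \<Rightarrow> real \<Rightarrow> real \<Rightarrow> real" where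
  "height_interp b q \<alpha> \<omega> X Y =
     (1 - frac Y) * height_interp_x b q \<alpha> \<omega> X (nat \<lfloor>Y\<rfloor>)
     + frac Y * height_interp_x b q \<alpha> \<omega> X (nat \<lfloor>Y\<rfloor> + 1)"

text \<open>The law of the samples: independent and uniform on \<open>[0,1]\<close>, one for each vertex.\<close>

definition vertex_noise :: "(nat \<times> nat \<Rightarrow> real) measure" where
  "vertex_noise = Pi\<^sub>M UNIV (\<lambda>_. uniform_measure lborel {0..1})"

section \<open>Convergence in probability\<close>

text \<open>
  Measurability is part of the definition because \<^const>\<open>measure\<close> is \<open>0\<close> on non-measurable sets.
\<close>

definition tendsto_in_prob :: "'w measure \<Rightarrow> ('i \<Rightarrow> 'w \<Rightarrow> real) \<Rightarrow> real \<Rightarrow> 'i filter \<Rightarrow> bool" where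
  "tendsto_in_prob M X c F \<longleftrightarrow>
     (\<forall>\<^sub>F i in F. X i \<in> borel_measurable M) \<and>
     (\<forall>\<epsilon>>0. ((\<lambda>i. measure M {\<omega> \<in> space M. \<bar>X i \<omega> - c\<bar> > \<epsilon>}) \<longlongrightarrow> 0) F)"

section \<open>The equation for the limit shape\<close>

definition limit_lhs :: "real \<Rightarrow> real \<Rightarrow> real \<Rightarrow> real \<Rightarrow> real \<Rightarrow> real" where
  "limit_lhs qq \<alpha> x y h =
     (if \<alpha> = 0 then qq powr h - 1
      else (qq powr (- h) * qq powr (y - x) + inverse \<alpha>) * (qq powr h - 1) / (1 + inverse \<alpha>))"

definition limit_integrand :: "real \<Rightarrow> real \<Rightarrow> real \<Rightarrow> real \<Rightarrow> complex \<Rightarrow> complex" where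
  "limit_integrand qq s x y z =
     exp (of_real (ln qq) *
       (- of_real x * (of_real s * z / (1 + of_real s * z)) + of_real y * (z / (1 + z)))) / z"

definition limit_rhs :: "(real \<Rightarrow> complex) \<Rightarrow> real \<Rightarrow> real \<Rightarrow> real \<Rightarrow> real \<Rightarrow> complex" where
  "limit_rhs \<gamma> qq s x y =
     1 / (2 * of_real pi * \<i>) * contour_integral \<gamma> (limit_integrand qq s x y)"

text \<open>
  Winding numbers express that \<open>\<gamma>\<close> goes once around \<open>-1\<close> in the positive direction and that \<open>0\<close> and
  \<open>-1/s\<close> lie outside.
\<close>

definition admissible_contour :: "real \<Rightarrow> (real \<Rightarrow> complex) \<Rightarrow> bool" where
  "admissible_contour s \<gamma> \<longleftrightarrow>
     valid_path \<gamma> \<and> pathfinish \<gamma> = pathstart \<gamma> \<and>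
     path_image \<gamma> \<inter> {- 1, 0, - 1 / of_real s} = {} \<and>
     winding_number \<gamma> (- 1) = 1 \<and>
     winding_number \<gamma> 0 = 0 \<and>
     winding_number \<gamma> (- 1 / of_real s) = 0"

lemma admissible_contour_exists:
  fixes s :: real
  assumes "s > 0" "s \<noteq> 1"
  shows "\<exists>\<gamma>. admissible_contour s \<gamma>"
proof -
  define r where "r = min 1 \<bar>1 - 1/s\<bar> / 2"
  have r: "r > 0" "r < 1" "r < \<bar>1 - 1/s\<bar>" using assms by (auto simp: r_def min_def field_simps)
  have d0: "dist (-1::complex) 0 = 1" by simp
  have "dist (-1::complex) (-1/of_real s) = norm (of_real (1/s - 1) :: complex)"
    unfolding dist_norm by (simp add: norm_minus_commute)
  also have "\<dots> = \<bar>1 - 1/s\<bar>" by (simp only: norm_of_real abs_minus_commute)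
  finally have d1: "dist (-1::complex) (-1/of_real s) = \<bar>1 - 1/s\<bar>" .
  have out: "winding_number (circlepath (-1) r) w = 0" if "dist (-1) w > r" for w
    by (rule winding_number_zero_outside[of _ "cball (-1) r"]) (use that r in auto)
  have "admissible_contour s (circlepath (-1) r)"
    unfolding admissible_contour_def
    using r d0 d1 out[of 0] out[of "-1/of_real s"]
    by (auto simp: winding_number_circlepath_centre)
  then show ?thesis by blast
qed

end

theory Submission
  imports Defs "HOL-Real_Asymp.Real_Asymp"
begin

text \<open>
  The proof linearizes the model. At a lattice point put
  \<open>F = (q^H - 1) (1 + \<alpha> q^(y - x + 1 - H))\<close>, where \<open>H\<close> is the height. The vertex weights are such
  that, around each vertex, the values of \<open>F\<close> on the four adjacent faces satisfy a linear relation
  with constant coefficients \<open>b\<close>, \<open>bq\<close> and \<open>1 - b - bq\<close> up to an error, the innovation, which has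
  mean zero given all samples at other vertices. The dynamic parameter disappears from the relation
  and survives only in the boundary value \<open>F(1,y) = (1 + \<alpha>) (q^y - 1)\<close>; this is where the prefactor
  \<open>1 + \<alpha>\<close> of the limit equation comes from. The relation is a discrete telegraph equation, since its
  characteristic polynomial factors as \<open>(A - b) (B - bq) = (1 - b) (1 - bq)\<close>.

  \<^emph>\<open>Concentration.\<close> An innovation takes two values that differ by \<open>O(1/L)\<close>, and the less likely one,
  which belongs to a turning path, has probability \<open>O(1/L)\<close>. So its variance is \<open>O(1/L^3)\<close>.
  Innovations at distinct vertices are orthogonal, hence the \<open>O(L^2)\<close> of them that influence a lattice
  point contribute a total variance \<open>O(1/L)\<close>. Solving the telegraph equation with the innovations as
  source and applying a Gronwall estimate to first moments shows that \<open>F\<close> is close to its mean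
  (\<open>obs_concentration\<close>).

  \<^emph>\<open>The mean.\<close> The mean of \<open>F\<close> solves the telegraph equation without source exactly. Its solutions
  \<open>A^m B^n\<close> are parametrized by a point \<open>z\<close> of the complex plane, and integrating them against \<open>dz/z\<close>
  around \<open>-1\<close> reproduces the boundary values (\<open>mean_contour_integral\<close>). Under the scaling of the
  parameters \<open>A^m\<close> and \<open>B^n\<close> are powers of the form \<open>(1 + O(1/L))^O(L)\<close>, so they converge to
  exponentials uniformly on a circle around \<open>-1\<close>, and the integral converges to the right-hand side of
  the limit equation (\<open>mean_tendsto\<close>).

  \<^emph>\<open>Inversion.\<close> As a function of \<open>H/L\<close> the observable is strictly monotone and, up to a constant factor,
  expansive on bounded sets, so convergence of \<open>F\<close> in mean gives convergence of \<open>H/L\<close> in mean to the unique solution of the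
  limit equation (\<open>height_L1_limit\<close>). The interpolated height at a real point is a convex combination
  of the heights at four lattice points, all of which have the same limit, and Markov's inequality
  turns convergence in mean into convergence in probability.
\<close>

section \<open>Heights and path conservation\<close>

lemma height_0 [simp]: "height b q \<alpha> \<eta> x 0 = 0"
  by (simp add: height_def)

lemma height_Suc:
  "height b q \<alpha> \<eta> x (Suc y) = height b q \<alpha> \<eta> x y + of_bool (enters_left b q \<alpha> \<eta> x (Suc y))"
proof -
  have "int (height b q \<alpha> \<eta> x (Suc y)) =
      int (height b q \<alpha> \<eta> x y + of_bool (enters_left b q \<alpha> \<eta> x (Suc y)))"
    unfolding sum_enters_left_eq_height[symmetric] of_nat_add by simp
  then show ?thesis by linarith
qed

lemma height_first_column [simp]: "height b q \<alpha> \<eta> (Suc 0) y = y"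
  by (induction y) (simp_all add: height_Suc)

lemma height_le: "height b q \<alpha> \<eta> x y \<le> y"
  by (induction y) (auto simp: height_Suc)

lemma enters_left_height:
  "enters_left b q \<alpha> \<eta> (Suc (Suc x)) y =
     exits_right b q \<alpha> (int (Suc x) - int y - 1 + 2 * int (height b q \<alpha> \<eta> (Suc x) y))
       (\<eta> (Suc x, y)) (enters_left b q \<alpha> \<eta> (Suc x) y) (enters_below b q \<alpha> \<eta> (Suc x) y)"
  unfolding enters_left.simps sum_enters_left_eq_height ..

lemma enters_below_height:
  "enters_below b q \<alpha> \<eta> x (Suc (Suc y)) =
     exits_up b q \<alpha> (int x - int (Suc y) - 1 + 2 * int (height b q \<alpha> \<eta> x (Suc y)))
       (\<eta> (x, Suc y)) (enters_left b q \<alpha> \<eta> x (Suc y)) (enters_below b q \<alpha> \<eta> x (Suc y))"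
  unfolding enters_below.simps sum_enters_left_eq_height ..

lemma exits_conservation:
  "of_bool (exits_right b q \<alpha> d u l v) + of_bool (exits_up b q \<alpha> d u l v) = (of_bool l + of_bool v :: nat)"
  by (auto simp: exits_right_def exits_up_def)

text \<open>
  A path that crosses column \<open>x\<close> from the left at height at most \<open>y\<close> either leaves it to the right at
  height at most \<open>y\<close> or is the one that passes upwards out of \<open>(x,y)\<close>. So the heights on the four faces
  around a vertex are determined by one of them and by the occupation of the edges at the vertex.
\<close>

lemma height_next_column:
  "height b q \<alpha> \<eta> (Suc (Suc x)) y + of_bool (enters_below b q \<alpha> \<eta> (Suc x) (Suc y))
     = height b q \<alpha> \<eta> (Suc x) y"
proof (induction y)
  case (Suc y)
  show ?case
    using Suc exits_conservation[of b q \<alpha>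
        "int (Suc x) - int (Suc y) - 1 + 2 * int (height b q \<alpha> \<eta> (Suc x) (Suc y))"
        "\<eta> (Suc x, Suc y)" "enters_left b q \<alpha> \<eta> (Suc x) (Suc y)" "enters_below b q \<alpha> \<eta> (Suc x) (Suc y)"]
    unfolding enters_below_height height_Suc[of b q \<alpha> \<eta> "Suc (Suc x)"] enters_left_height
      height_Suc[of b q \<alpha> \<eta> "Suc x"]
    by linarith
qed simp

text \<open>
  Locality: the edge entering \<open>(x,y)\<close> from the left depends only on samples strictly to the left and
  not above, and the edge entering from below only on samples strictly below and not to the right.
  In particular the incoming edges at a vertex do not depend on the sample used there.
\<close>

lemma enters_update:
  "\<not> (fst v < x \<and> snd v \<le> y) \<Longrightarrow> enters_left b q \<alpha> (\<eta>(v := u)) x y = enters_left b q \<alpha> \<eta> x y"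
  "\<not> (fst v \<le> x \<and> snd v < y) \<Longrightarrow> enters_below b q \<alpha> (\<eta>(v := u)) x y = enters_below b q \<alpha> \<eta> x y"
proof (induction b q \<alpha> \<eta> x y and b q \<alpha> \<eta> x y rule: enters_left_enters_below.induct)
  case (3 b q \<alpha> \<eta> x y)
  have IH: "enters_left b q \<alpha> (\<eta>(v := u)) (Suc x) y' = enters_left b q \<alpha> \<eta> (Suc x) y'"
    if "y' \<in> {1..y}" for y'
    by (rule 3(1)[OF that]) (use 3(4) that in auto)
  have "(\<Sum>y'=1..y. of_bool (enters_left b q \<alpha> (\<eta>(v := u)) (Suc x) y')) =
        (\<Sum>y'=1..y. of_bool (enters_left b q \<alpha> \<eta> (Suc x) y') :: int)"
    by (rule sum.cong[OF refl]) (simp only: IH)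
  moreover have "(\<eta>(v := u)) (Suc x, y) = \<eta> (Suc x, y)"
    using 3(4) by (cases v) auto
  moreover have "enters_left b q \<alpha> (\<eta>(v := u)) (Suc x) y = enters_left b q \<alpha> \<eta> (Suc x) y"
    by (rule 3(2)) (use 3(4) in auto)
  moreover have "enters_below b q \<alpha> (\<eta>(v := u)) (Suc x) y = enters_below b q \<alpha> \<eta> (Suc x) y"
    by (rule 3(3)) (use 3(4) in auto)
  ultimately show ?case by (simp only: enters_left.simps)
next
  case (6 b q \<alpha> \<eta> x y)
  have IH: "enters_left b q \<alpha> (\<eta>(v := u)) x y' = enters_left b q \<alpha> \<eta> x y'"
    if "y' \<in> {1..Suc y}" for y'
    by (rule 6(1)[OF that]) (use 6(4) that in auto)
  have "(\<Sum>y'=1..Suc y. of_bool (enters_left b q \<alpha> (\<eta>(v := u)) x y')) =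
        (\<Sum>y'=1..Suc y. of_bool (enters_left b q \<alpha> \<eta> x y') :: int)"
    by (rule sum.cong[OF refl]) (simp only: IH)
  moreover have "(\<eta>(v := u)) (x, Suc y) = \<eta> (x, Suc y)"
    using 6(4) by (cases v) auto
  moreover have "enters_left b q \<alpha> (\<eta>(v := u)) x (Suc y) = enters_left b q \<alpha> \<eta> x (Suc y)"
    by (rule 6(2)) (use 6(4) in auto)
  moreover have "enters_below b q \<alpha> (\<eta>(v := u)) x (Suc y) = enters_below b q \<alpha> \<eta> x (Suc y)"
    by (rule 6(3)) (use 6(4) in auto)
  ultimately show ?case by (simp only: enters_below.simps)
qed simp_all

lemma height_update:
  assumes "\<not> (fst v < x \<and> snd v \<le> y)"
  shows "height b q \<alpha> (\<eta>(v := u)) x y = height b q \<alpha> \<eta> x y"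
proof -
  have "enters_left b q \<alpha> (\<eta>(v := u)) x y' = enters_left b q \<alpha> \<eta> x y'" if "y' \<le> y" for y'
    using assms that by (intro enters_update) auto
  then have "{y' \<in> {1..y}. enters_left b q \<alpha> (\<eta>(v := u)) x y'} = {y' \<in> {1..y}. enters_left b q \<alpha> \<eta> x y'}"
    by auto
  then show ?thesis by (simp only: height_def)
qed

section \<open>The observable and its innovations\<close>

text \<open>
  With \<open>c = y - x + 1\<close> this is the function of the height that satisfies a linear relation in the
  dynamic model. Multiplied out, it is \<open>q^h - \<alpha> q^(c - h)\<close> plus \<open>\<alpha> q^c - 1\<close>; the latter solves the linear
  relation by itself and is added to make the observable vanish at height \<open>0\<close>. The same function, with
  the base \<open>qq\<close> and up to the factor \<open>1 + \<alpha>\<close>, is the left-hand side of the limit equation.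
\<close>

definition height_transform :: "real \<Rightarrow> real \<Rightarrow> real \<Rightarrow> real \<Rightarrow> real" where
  "height_transform qq \<alpha> c h = (qq powr h - 1) * (1 + \<alpha> * qq powr (c - h))"

lemma height_transform_expand: "height_transform qq \<alpha> c h = qq powr h - \<alpha> * qq powr (c - h) + \<alpha> * qq powr c - 1"
proof -
  have "qq powr h * qq powr (c - h) = qq powr c"
    by (simp flip: powr_add)
  then show ?thesis by (simp add: height_transform_def algebra_simps)
qed

locale dynamic_six_vertex =
  fixes b q \<alpha> :: real
  assumes q_pos: "0 < q" and b_pos: "0 < b" and b_less: "b < 1" and bq_less: "b * q < 1" and \<alpha>_nonneg: "0 \<le> \<alpha>"
begin

text \<open>
  Indices are shifted so that the boundary is at \<open>m = 0\<close> and \<open>n = 0\<close>: the pair \<open>(m,n)\<close> stands for the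
  lattice point \<open>(m + 1, n)\<close>, and the vertex whose four faces enter \<open>innovation i j\<close> below is
  \<open>(i + 1, j + 1)\<close>.
\<close>

definition obs :: "(nat \<times> nat \<Rightarrow> real) \<Rightarrow> nat \<Rightarrow> nat \<Rightarrow> real" where
  "obs \<eta> m n = height_transform q \<alpha> (real n - real m) (real (height b q \<alpha> \<eta> (Suc m) n))"

definition innovation :: "nat \<Rightarrow> nat \<Rightarrow> (nat \<times> nat \<Rightarrow> real) \<Rightarrow> real" where
  "innovation i j \<eta> = obs \<eta> (Suc i) (Suc j) - b * obs \<eta> i (Suc j) - b * q * obs \<eta> (Suc i) j
     - (1 - b - b * q) * obs \<eta> i j"

text \<open>
  Both straight-path probabilities are weighted averages of \<open>b\<close> and \<open>bq\<close>, with weights depending on the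
  dynamic variable. This bounds the turning probability uniformly in the state of the system.
\<close>

lemma straight_from_left_bounds:
  "min b (b*q) \<le> straight_from_left b q \<alpha> d" "straight_from_left b q \<alpha> d \<le> max b (b*q)"
proof -
  define e where "e = q powi d"
  have e: "e > 0" using q_pos by (simp add: e_def zero_less_power_int)
  have eq: "straight_from_left b q \<alpha> d = (b * e + (b*q) * \<alpha>) / (e + \<alpha>)"
    by (simp add: straight_from_left_def e_def algebra_simps add_divide_distrib)
  have "min b (b*q) * e + min b (b*q) * \<alpha> \<le> b * e + (b*q) * \<alpha>"
    using e \<alpha>_nonneg by (intro add_mono mult_right_mono) auto
  then show "min b (b*q) \<le> straight_from_left b q \<alpha> d"
    unfolding eq using e \<alpha>_nonneg by (simp add: pos_le_divide_eq algebra_simps)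
  have "b * e + (b*q) * \<alpha> \<le> max b (b*q) * e + max b (b*q) * \<alpha>"
    using e \<alpha>_nonneg by (intro add_mono mult_right_mono) auto
  then show "straight_from_left b q \<alpha> d \<le> max b (b*q)"
    unfolding eq using e \<alpha>_nonneg by (simp add: pos_divide_le_eq algebra_simps)
qed

lemma straight_from_below_bounds:
  "min b (b*q) \<le> straight_from_below b q \<alpha> d" "straight_from_below b q \<alpha> d \<le> max b (b*q)"
proof -
  define e where "e = q powi d"
  have e: "e > 0" using q_pos by (simp add: e_def zero_less_power_int)
  have eq: "straight_from_below b q \<alpha> d = ((b*q) * e + b * \<alpha>) / (e + \<alpha>)"
    using q_pos by (simp add: straight_from_below_def e_def algebra_simps add_divide_distrib power_int_add)
  have "min b (b*q) * e + min b (b*q) * \<alpha> \<le> (b*q) * e + b * \<alpha>"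
    using e \<alpha>_nonneg by (intro add_mono mult_right_mono) auto
  then show "min b (b*q) \<le> straight_from_below b q \<alpha> d"
    unfolding eq using e \<alpha>_nonneg by (simp add: pos_le_divide_eq algebra_simps)
  have "(b*q) * e + b * \<alpha> \<le> max b (b*q) * e + max b (b*q) * \<alpha>"
    using e \<alpha>_nonneg by (intro add_mono mult_right_mono) auto
  then show "straight_from_below b q \<alpha> d \<le> max b (b*q)"
    unfolding eq using e \<alpha>_nonneg by (simp add: pos_divide_le_eq algebra_simps)
qed

text \<open>
  The heart of the linearization. If zero or two paths enter the vertex, its outcome is certain and the
  four face values satisfy the telegraph relation exactly. If a single path enters, write \<open>t = q^A\<close> and
  \<open>u = \<alpha> q^(j - i - A)\<close>, where \<open>A\<close> is the height on the lower left face. The straight-path probability is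
  then \<open>b (t + u) / (t + u/q)\<close> or \<open>b (t + u) / (t/q + u)\<close>, and its denominator is proportional to the
  difference of the two possible values, so that the mean is an affine function of \<open>t\<close> and \<open>u\<close>,
  namely the one prescribed by the relation.
\<close>

lemma innovation_two_valued:
  fixes \<eta> i j
  defines "A \<equiv> height b q \<alpha> \<eta> (Suc i) j"
  defines "t \<equiv> q powr real A" and "u \<equiv> \<alpha> * q powr (real j - real i - real A)"
  obtains p s s' where "min b (b*q) \<le> p" "p \<le> max b (b*q)" "p * s + (1 - p) * s' = 0"
    "\<bar>s - s'\<bar> \<le> \<bar>1 - q\<bar> * (1 + 1/q) * (t + u)"
    "\<And>w. innovation i j (\<eta>((Suc i, Suc j) := w)) = (if w < p then s else s')"
proof -
  define l where "l = enters_left b q \<alpha> \<eta> (Suc i) (Suc j)"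
  define v where "v = enters_below b q \<alpha> \<eta> (Suc i) (Suc j)"
  define d where "d = int i - int j - 1 + 2 * int (A + of_bool l)"
  have t: "t > 0" using q_pos by (simp add: t_def)
  have u: "u \<ge> 0" using q_pos \<alpha>_nonneg by (simp add: u_def)
  define ex where "ex w = exits_right b q \<alpha> d w l v" for w
  define c where "c = \<alpha> * q powr (real j - real i)"
  have P: "q powr (real A + e) = t * q powr e" for e
    by (simp add: t_def powr_add)
  have Q: "\<alpha> * q powr (real j - real i - real A + e) = u * q powr e" for e
    unfolding u_def powr_add by simp
  have C: "\<alpha> * q powr (real j - real i + e) = c * q powr e" for e
    unfolding c_def powr_add by simp
  have hSW: "height b q \<alpha> (\<eta>((Suc i, Suc j) := w)) (Suc i) j = A" for w
    using height_update[of "(Suc i, Suc j)" "Suc i" j] by (simp add: A_def)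
  have upd_SW: "obs (\<eta>((Suc i, Suc j) := w)) i j = t - u + c - 1" for w
    unfolding obs_def height_transform_expand hSW by (simp add: t_def u_def c_def)
  have hNW: "height b q \<alpha> (\<eta>((Suc i, Suc j) := w)) (Suc i) (Suc j) = A + of_bool l" for w
    using height_update[of "(Suc i, Suc j)" "Suc i" "Suc j"] by (simp add: height_Suc A_def l_def)
  have upd_NW: "obs (\<eta>((Suc i, Suc j) := w)) i (Suc j) = t * q powr of_bool l - u * q powr (1 - of_bool l) + c * q - 1" for w
  proof -
    have "real (Suc j) - real i - real (A + of_bool l) = real j - real i - real A + (1 - of_bool l)"
      "real (Suc j) - real i = real j - real i + 1" "real (A + of_bool l) = real A + of_bool l"
      by simp_all
    then show ?thesis
      unfolding obs_def height_transform_expand hNW by (simp only: P Q C) (use q_pos in simp)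
  qed
  have hv: "A = height b q \<alpha> \<eta> (Suc (Suc i)) j + of_bool v"
    unfolding A_def v_def height_next_column ..
  have hSE: "height b q \<alpha> (\<eta>((Suc i, Suc j) := w)) (Suc (Suc i)) j = A - of_bool v" for w
    using height_update[of "(Suc i, Suc j)" "Suc (Suc i)" j] hv by simp
  have rA: "real (A - of_bool v) = real A + - of_bool v" using hv by auto
  have upd_SE: "obs (\<eta>((Suc i, Suc j) := w)) (Suc i) j = t * q powr (- of_bool v) - u * q powr (of_bool v - 1) + c / q - 1" for w
  proof -
    have "real j - real (Suc i) - (real A + - of_bool v) = real j - real i - real A + (of_bool v - 1)"
      "real j - real (Suc i) = real j - real i + -1"
      by simp_all
    then show ?thesis
      unfolding obs_def height_transform_expand hSE rA by (simp only: P Q C) (use q_pos in \<open>simp add: powr_minus divide_inverse\<close>)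
  qed
  have hNE: "height b q \<alpha> (\<eta>((Suc i, Suc j) := w)) (Suc (Suc i)) (Suc j) = A - of_bool v + of_bool (ex w)" for w
  proof -
    have "enters_left b q \<alpha> (\<eta>((Suc i, Suc j) := w)) (Suc i) (Suc j) = l"
      "enters_below b q \<alpha> (\<eta>((Suc i, Suc j) := w)) (Suc i) (Suc j) = v"
      by (simp_all add: enters_update l_def v_def)
    moreover have "int (Suc i) - int (Suc j) - 1 + 2 * int (A + of_bool l) = d" by (simp add: d_def)
    ultimately have "enters_left b q \<alpha> (\<eta>((Suc i, Suc j) := w)) (Suc (Suc i)) (Suc j) = ex w"
      unfolding enters_left_height hNW ex_def by (simp only: fun_upd_same)
    then show ?thesis unfolding height_Suc[of _ _ _ _ "Suc (Suc i)"] hSE by simp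
  qed
  have rA': "real (A - of_bool v + of_bool (ex w)) = real A + (of_bool (ex w) - of_bool v)" for w 
    using rA by (simp add: of_nat_add)
  have upd_NE: "obs (\<eta>((Suc i, Suc j) := w)) (Suc i) (Suc j)
      = t * q powr (of_bool (ex w) - of_bool v) - u * q powr (of_bool v - of_bool (ex w)) + c - 1" for w
  proof -
    have "real (Suc j) - real (Suc i) - (real A + (of_bool (ex w) - of_bool v)) = real j - real i - real A + (of_bool v - of_bool (ex w))"
      "real (Suc j) - real (Suc i) = real j - real i + 0"
      by simp_all
    then show ?thesis
      unfolding obs_def height_transform_expand hNE rA' by (simp only: P Q C) (use q_pos in simp)
  qed
  define D where "D e = t * q powr (of_bool e - of_bool v) - u * q powr (of_bool v - of_bool e)
      - b * (t * q powr of_bool l - u * q powr (1 - of_bool l))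
      - b * q * (t * q powr (- of_bool v) - u * q powr (of_bool v - 1))
      - (1 - b - b * q) * (t - u)" for e
  have innovation_D: "innovation i j (\<eta>((Suc i, Suc j) := w)) = D (ex w)" for w
    unfolding innovation_def upd_NE upd_NW upd_SE upd_SW D_def using q_pos by (simp add: field_simps)
  have mm: "min b (b*q) \<le> b" "b \<le> max b (b*q)" by auto
  \<comment> \<open>\<open>q powi d\<close> is a multiple of \<open>t / u\<close>; without division, because \<open>u\<close> vanishes for \<open>\<alpha> = 0\<close>\<close>
  have qd: "q powi d * u = \<alpha> * q * t" if "l"
  proof -
    have "q powi d = q powr (real_of_int d)" using q_pos by (simp add: powr_real_of_int')
    moreover have "real_of_int d + (real j - real i - real A) = 1 + real A" using that by (simp add: d_def)
    ultimately have "q powi d * u = \<alpha> * q powr (1 + real A)"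
      unfolding u_def by (metis (no_types, lifting) mult.left_commute powr_add)
    then show ?thesis using q_pos by (simp add: powr_add t_def)
  qed
  have qd': "q * q powi d * u = \<alpha> * t" if "\<not> l"
  proof -
    have "q powi d = q powr (real_of_int d)" using q_pos by (simp add: powr_real_of_int')
    moreover have "1 + (real_of_int d + (real j - real i - real A)) = real A" using that by (simp add: d_def)
    moreover have "q = q powr 1" using q_pos by simp
    ultimately have "q * q powi d * u = \<alpha> * q powr real A"
      unfolding u_def by (metis (no_types, lifting) mult.left_commute mult.assoc powr_add)
    then show ?thesis using q_pos by (simp add: t_def)
  qed
  have e: "q powi d > 0" using q_pos by (simp add: zero_less_power_int)
  have E: "q powi d + \<alpha> > 0" using e \<alpha>_nonneg by linarith
  show thesis
  proof (cases "l = v")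
    case True
    have "ex w = l" for w using True by (auto simp: ex_def exits_right_def)
    moreover have "D l = 0" using True q_pos by (cases l) (auto simp: D_def powr_minus field_simps)
    ultimately have "innovation i j (\<eta>((Suc i, Suc j) := w)) = (if w < b then 0 else 0)" for w
      unfolding innovation_D by simp
    then show thesis using that[of b 0 0] t u q_pos mm by auto
  next
    case False
    show thesis
    proof (cases l)
      case l: True
      then have v: "\<not> v" using False by simp
      define p where "p = straight_from_left b q \<alpha> d"
      have ex: "ex w = (w < p)" for w using l v by (auto simp: ex_def exits_right_def p_def)
      have tu: "t + u / q > 0" using t u q_pos by (simp add: add_pos_nonneg)
      have Es: "D True - D False = (q - 1) * (t + u / q)"
        using q_pos l v by (simp add: D_def powr_minus field_simps)
      have Ef: "D False = - (b * (q - 1) * (t + u))"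
        using q_pos l v by (simp add: D_def powr_minus field_simps)
      have pp: "p * (t + u / q) = b * (t + u)"
      proof -
        have "(q powi d + \<alpha> * q) * (t + u / q) = (t + u) * (q powi d + \<alpha>)"
          using qd[OF l] q_pos by (simp add: field_simps)
        moreover have "p * (t + u / q) = b * ((q powi d + \<alpha> * q) * (t + u / q)) / (q powi d + \<alpha>)"
          unfolding p_def straight_from_left_def by simp
        ultimately show ?thesis using E by simp
      qed
      have "p * D True + (1 - p) * D False = p * (D True - D False) + D False"
        by (simp add: algebra_simps)
      also have "\<dots> = (q - 1) * (p * (t + u / q)) + D False"
        unfolding Es by (simp only: mult.left_commute)
      finally have "p * D True + (1 - p) * D False = (q - 1) * (p * (t + u / q)) + D False" .
      then have "p * D True + (1 - p) * D False = 0" unfolding pp Ef by simp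
      moreover have "\<bar>D True - D False\<bar> \<le> \<bar>1 - q\<bar> * (1 + 1/q) * (t + u)"
      proof -
        have "t + u / q \<le> (1 + 1/q) * (t + u)" using t u q_pos by (simp add: field_simps)
        then have "\<bar>1 - q\<bar> * (t + u / q) \<le> \<bar>1 - q\<bar> * ((1 + 1/q) * (t + u))"
          by (intro mult_left_mono) auto
        then show ?thesis unfolding Es abs_mult using tu by (simp add: abs_minus_commute mult.assoc)
      qed
      ultimately show thesis using that[of p "D True" "D False"] straight_from_left_bounds[of d]
        unfolding innovation_D ex p_def by auto
    next
      case l: False
      then have v: v using False by simp
      define p where "p = straight_from_below b q \<alpha> d"
      have ex: "ex w = (\<not> w < p)" for w using l v by (auto simp: ex_def exits_right_def p_def)
      have tu: "t / q + u > 0" using t u q_pos by (simp add: add_pos_nonneg)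
      have Es: "D False - D True = (1 - q) * (t / q + u)"
        using q_pos l v by (simp add: D_def powr_minus field_simps)
      have Ef: "D True = - (b * (1 - q) * (t + u))"
        using q_pos l v by (simp add: D_def powr_minus field_simps)
      have pp: "p * (t / q + u) = b * (t + u)"
      proof -
        have "(q * q powi d + \<alpha>) * (t / q + u) = (t + u) * (q powi d + \<alpha>)"
          using qd'[OF l] q_pos by (simp add: field_simps)
        moreover have "p * (t / q + u) = b * ((q * q powi d + \<alpha>) * (t / q + u)) / (q powi d + \<alpha>)"
          unfolding p_def straight_from_below_def using q_pos by (simp add: power_int_add mult.commute[of q])
        ultimately show ?thesis using E by simp
      qed
      have "p * D False + (1 - p) * D True = p * (D False - D True) + D True"
        by (simp add: algebra_simps)
      also have "\<dots> = (1 - q) * (p * (t / q + u)) + D True"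
        unfolding Es by (simp only: mult.left_commute)
      finally have "p * D False + (1 - p) * D True = (1 - q) * (p * (t / q + u)) + D True" .
      then have "p * D False + (1 - p) * D True = 0" unfolding pp Ef by simp
      moreover have "\<bar>D False - D True\<bar> \<le> \<bar>1 - q\<bar> * (1 + 1/q) * (t + u)"
      proof -
        have "t / q + u \<le> (1 + 1/q) * (t + u)" using t u q_pos by (simp add: field_simps)
        then have "\<bar>1 - q\<bar> * (t / q + u) \<le> \<bar>1 - q\<bar> * ((1 + 1/q) * (t + u))"
          by (intro mult_left_mono) auto
        then show ?thesis unfolding Es abs_mult using tu by (simp add: abs_minus_commute mult.assoc)
      qed
      ultimately show thesis using that[of p "D False" "D True"] straight_from_below_bounds[of d]
        unfolding innovation_D ex p_def by auto
    qed
  qed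
qed

end

section \<open>Resampling one vertex\<close>

abbreviation unif :: "real measure" where
  "unif \<equiv> uniform_measure lborel {0..1}"

lemma prob_space_unif: "prob_space unif"
  by (rule prob_space_uniform_measure) auto

interpretation vertex_noise: prob_space vertex_noise
  unfolding vertex_noise_def by (rule prob_space_PiM) (rule prob_space_unif)

lemma measurable_sample [measurable]: "(\<lambda>\<eta>. \<eta> v) \<in> borel_measurable vertex_noise"
proof -
  have "(\<lambda>\<eta>. \<eta> v) \<in> measurable vertex_noise unif"
    unfolding vertex_noise_def by (rule measurable_component_singleton) simp
  then show ?thesis
    by (simp add: measurable_cong_sets[OF refl, of unif borel])
qed

text \<open>
  Fubini for one coordinate of the infinite product: replacing the sample at \<open>v\<close> by an independent
  copy does not change the law. Averaging over the fresh sample alone plays the role of the conditional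
  expectation given all other samples.
\<close>

lemma integral_resample:
  fixes f :: "(nat \<times> nat \<Rightarrow> real) \<Rightarrow> real"
  assumes f: "f \<in> borel_measurable vertex_noise" and B: "\<And>\<eta>. \<bar>f \<eta>\<bar> \<le> B"
  shows "(\<integral>\<eta>. f \<eta> \<partial>vertex_noise) = (\<integral>\<eta>. (\<integral>w. f (\<eta>(v := w)) \<partial>unif) \<partial>vertex_noise)"
proof -
  interpret U: prob_space unif by (rule prob_space_unif)
  interpret P: pair_prob_space unif vertex_noise ..
  have eq: "distr (unif \<Otimes>\<^sub>M vertex_noise) vertex_noise (\<lambda>(w, \<eta>). \<eta>(v := w)) = vertex_noise"
    using distr_pair_PiM_eq_PiM[of UNIV "\<lambda>_. unif" v] prob_space_unif
    by (simp add: vertex_noise_def)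
  have m: "(\<lambda>(w, \<eta>). \<eta>(v := w)) \<in> measurable (unif \<Otimes>\<^sub>M vertex_noise) vertex_noise"
    unfolding vertex_noise_def case_prod_beta'
    by (rule measurable_fun_upd[where J = UNIV]) auto
  have fm: "(\<lambda>z. f (case z of (w, \<eta>) \<Rightarrow> \<eta>(v := w))) \<in> borel_measurable (unif \<Otimes>\<^sub>M vertex_noise)"
    using measurable_compose[OF m f] .
  have "integrable (unif \<Otimes>\<^sub>M vertex_noise) (\<lambda>z. f (case z of (w, \<eta>) \<Rightarrow> \<eta>(v := w)))"
    by (rule P.integrable_const_bound[of _ B]) (use fm B in auto)
  then have int: "integrable (unif \<Otimes>\<^sub>M vertex_noise) (\<lambda>(w, \<eta>). f (\<eta>(v := w)))"
    by (simp add: case_prod_beta')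
  have "(\<integral>\<eta>. f \<eta> \<partial>vertex_noise) =
      (\<integral>\<eta>. f \<eta> \<partial>distr (unif \<Otimes>\<^sub>M vertex_noise) vertex_noise (\<lambda>(w, \<eta>). \<eta>(v := w)))"
    by (simp only: eq)
  also have "\<dots> = (\<integral>z. f (case z of (w, \<eta>) \<Rightarrow> \<eta>(v := w)) \<partial>(unif \<Otimes>\<^sub>M vertex_noise))"
    by (rule integral_distr[OF m f])
  also have "\<dots> = (\<integral>(w, \<eta>). f (\<eta>(v := w)) \<partial>(unif \<Otimes>\<^sub>M vertex_noise))"
    by (simp add: case_prod_beta')
  also have "\<dots> = (\<integral>\<eta>. (\<integral>w. f (\<eta>(v := w)) \<partial>unif) \<partial>vertex_noise)"
    by (rule P.integral_snd[OF int, symmetric])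
  finally show ?thesis .
qed

lemma integral_unif_two_valued:
  assumes "0 \<le> p" "p \<le> 1"
  shows "(\<integral>w. (if w < p then s else s') \<partial>unif) = p * s + (1 - p) * (s' :: real)"
proof -
  interpret U: prob_space unif by (rule prob_space_unif)
  have "{0..1} \<inter> {..<p} = {0..<p}" using assms by auto
  then have m: "measure unif {..<p} = p"
    using assms by (subst measure_uniform_measure) auto
  have "(\<lambda>w. if w < p then s else s') = (\<lambda>w. s' + indicator {..<p} w * (s - s'))"
    by (auto simp: indicator_def)
  moreover have "(\<integral>w. indicator {..<p} w \<partial>unif) = p"
    using m by (subst Bochner_Integration.integral_indicator) simp_all
  moreover have "integrable unif (indicator {..<p} :: real \<Rightarrow> real)"
    by (rule U.integrable_const_bound[of _ 1]) (auto intro!: borel_measurable_indicator)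
  ultimately have "(\<integral>w. (if w < p then s else s') \<partial>unif) = s' + p * (s - s')"
    by (simp add: U.prob_space[unfolded space_uniform_measure space_lborel space_borel] del: measure_uniform_measure)
  then show ?thesis by (simp add: algebra_simps)
qed

lemma measurable_exits [measurable]:
  assumes [measurable]: "d \<in> measurable M (count_space UNIV)" "f \<in> borel_measurable M"
    "Measurable.pred M l" "Measurable.pred M v"
  shows "Measurable.pred M (\<lambda>x. exits_right b q \<alpha> (d x) (f x) (l x) (v x))"
    "Measurable.pred M (\<lambda>x. exits_up b q \<alpha> (d x) (f x) (l x) (v x))"
proof -
  have [measurable]: "straight_from_left b q \<alpha> \<in> borel_measurable (count_space UNIV)"
    "straight_from_below b q \<alpha> \<in> borel_measurable (count_space UNIV)" by simp_all
  show "Measurable.pred M (\<lambda>x. exits_right b q \<alpha> (d x) (f x) (l x) (v x))"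
    "Measurable.pred M (\<lambda>x. exits_up b q \<alpha> (d x) (f x) (l x) (v x))"
    unfolding exits_right_def exits_up_def by measurable
qed

lemma measurable_height_of_enters_left:
  assumes "\<And>y'. y' \<in> {1..y} \<Longrightarrow> Measurable.pred vertex_noise (\<lambda>\<eta>. enters_left b q \<alpha> \<eta> x y')"
  shows "(\<lambda>\<eta>. height b q \<alpha> \<eta> x y) \<in> measurable vertex_noise (count_space UNIV)"
  using assms
proof (induction y)
  case (Suc y)
  have [measurable]: "Measurable.pred vertex_noise (\<lambda>\<eta>. enters_left b q \<alpha> \<eta> x (Suc y))"
    using Suc(2) by simp
  have [measurable]: "(\<lambda>\<eta>. height b q \<alpha> \<eta> x y) \<in> measurable vertex_noise (count_space UNIV)"
    using Suc by simp
  have "(\<lambda>\<eta>. height b q \<alpha> \<eta> x (Suc y)) = (\<lambda>\<eta>. if enters_left b q \<alpha> \<eta> x (Suc y)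
     then Suc (height b q \<alpha> \<eta> x y) else height b q \<alpha> \<eta> x y)"
    by (auto simp: height_Suc)
  then show ?case by simp
qed simp

text \<open>
  The induction rule of the recursive definition also generalizes over the sample configuration; the
  zero configuration is a dummy argument for it.
\<close>

lemma measurable_enters [measurable]:
  "Measurable.pred vertex_noise (\<lambda>\<eta>. enters_left b q \<alpha> \<eta> x y)"
  "Measurable.pred vertex_noise (\<lambda>\<eta>. enters_below b q \<alpha> \<eta> x y)"
proof (induction b q \<alpha> "\<lambda>_::nat \<times> nat. 0 :: real" x y and b q \<alpha> "\<lambda>_::nat \<times> nat. 0 :: real" x y rule: enters_left_enters_below.induct)
  case (3 b q \<alpha> x y)
  note [measurable] = measurable_height_of_enters_left[OF 3(1)] 3(2,3)
  show ?case unfolding enters_left_height by measurable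
next
  case (6 b q \<alpha> x y)
  note [measurable] = measurable_height_of_enters_left[OF 6(1)] 6(2,3)
  show ?case unfolding enters_below_height by measurable
qed simp_all

lemma measurable_height [measurable]:
  "(\<lambda>\<eta>. height b q \<alpha> \<eta> x y) \<in> measurable vertex_noise (count_space UNIV)"
  by (rule measurable_height_of_enters_left) measurable

lemma bounded_integrable:
  assumes "f \<in> borel_measurable vertex_noise" "\<exists>B. \<forall>\<eta>. \<bar>f \<eta>\<bar> \<le> B"
  shows "integrable vertex_noise (f :: _ \<Rightarrow> real)"
proof -
  obtain B where "\<forall>\<eta>. \<bar>f \<eta>\<bar> \<le> B" using assms(2) by blast
  then show ?thesis by (intro vertex_noise.integrable_const_bound[of _ B] assms) auto
qed

lemma bounded_mult:
  assumes "\<exists>B. \<forall>\<eta>::'x. \<bar>f \<eta>\<bar> \<le> (B::real)" "\<exists>B. \<forall>\<eta>. \<bar>g \<eta>\<bar> \<le> B"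
  shows "\<exists>B. \<forall>\<eta>. \<bar>f \<eta> * g \<eta>\<bar> \<le> B"
proof -
  obtain B C where "\<forall>\<eta>. \<bar>f \<eta>\<bar> \<le> B" "\<forall>\<eta>. \<bar>g \<eta>\<bar> \<le> C" using assms by blast
  then have "\<forall>\<eta>. \<bar>f \<eta> * g \<eta>\<bar> \<le> B * C"
    unfolding abs_mult using abs_ge_zero order_trans by (blast intro: mult_mono)
  then show ?thesis by blast
qed

section \<open>Orthogonal sums and two-dimensional recurrences\<close>

lemma (in prob_space) expectation_square_orthogonal_sum:
  fixes X :: "'i \<Rightarrow> 'a \<Rightarrow> real"
  assumes "finite A"
    and int: "\<And>i j. i \<in> A \<Longrightarrow> j \<in> A \<Longrightarrow> integrable M (\<lambda>\<eta>. X i \<eta> * X j \<eta>)"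
    and orth: "\<And>i j. i \<in> A \<Longrightarrow> j \<in> A \<Longrightarrow> i \<noteq> j \<Longrightarrow> expectation (\<lambda>\<eta>. X i \<eta> * X j \<eta>) = 0"
  shows "expectation (\<lambda>\<eta>. (\<Sum>i\<in>A. c i * X i \<eta>)\<^sup>2) = (\<Sum>i\<in>A. (c i)\<^sup>2 * expectation (\<lambda>\<eta>. (X i \<eta>)\<^sup>2))"
proof -
  have "expectation (\<lambda>\<eta>. (\<Sum>i\<in>A. c i * X i \<eta>)\<^sup>2) =
      expectation (\<lambda>\<eta>. \<Sum>i\<in>A. \<Sum>j\<in>A. (c i * c j) * (X i \<eta> * X j \<eta>))"
    by (simp add: power2_eq_square sum_product mult.assoc mult.left_commute mult.commute)
  also have "\<dots> = (\<Sum>i\<in>A. \<Sum>j\<in>A. (c i * c j) * expectation (\<lambda>\<eta>. X i \<eta> * X j \<eta>))"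
    using int by (simp add: integral_sum integrable_sum)
  also have "\<dots> = (\<Sum>i\<in>A. \<Sum>j\<in>A. if j = i then (c i)\<^sup>2 * expectation (\<lambda>\<eta>. (X i \<eta>)\<^sup>2) else 0)"
    using orth by (intro sum.cong refl) (auto simp: power2_eq_square)
  also have "\<dots> = (\<Sum>i\<in>A. (c i)\<^sup>2 * expectation (\<lambda>\<eta>. (X i \<eta>)\<^sup>2))"
    using \<open>finite A\<close> by (simp add: sum.delta)
  finally show ?thesis .
qed

lemma (in prob_space) expectation_abs_le_sqrt:
  fixes X :: "'a \<Rightarrow> real"
  assumes "integrable M X" "integrable M (\<lambda>\<eta>. (X \<eta>)\<^sup>2)"
  shows "expectation (\<lambda>\<eta>. \<bar>X \<eta>\<bar>) \<le> sqrt (expectation (\<lambda>\<eta>. (X \<eta>)\<^sup>2))"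
proof -
  have "0 \<le> variance (\<lambda>\<eta>. \<bar>X \<eta>\<bar>)" by (rule variance_positive)
  also have "variance (\<lambda>\<eta>. \<bar>X \<eta>\<bar>) = expectation (\<lambda>\<eta>. \<bar>X \<eta>\<bar>\<^sup>2) - (expectation (\<lambda>\<eta>. \<bar>X \<eta>\<bar>))\<^sup>2"
    by (rule variance_eq) (use assms in auto)
  finally show ?thesis by (intro real_le_rsqrt) simp
qed

lemma linear_recurrence_solution:
  fixes u g :: "nat \<Rightarrow> real"
  assumes "u 0 = 0" "\<And>n. u (Suc n) = c * u n + g n"
  shows "u n = (\<Sum>j<n. c ^ (n - 1 - j) * g j)"
proof (induction n)
  case (Suc n)
  have "c * (c ^ (n - 1 - j) * g j) = c ^ (n - j) * g j" if "j < n" for j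
  proof -
    have "n - j = Suc (n - 1 - j)" using that by simp
    then show ?thesis by simp
  qed
  then have "c * u n = (\<Sum>j<n. c ^ (n - j) * g j)"
    unfolding Suc sum_distrib_left by (intro sum.cong) simp_all
  then show ?case by (simp add: assms(2))
qed (simp add: assms)

text \<open>
  The characteristic polynomial \<open>AB - bB - cA + bc = (A - b) (B - c)\<close> of the left-hand side factors, so
  the recurrence is solved by two first-order recurrences, one in each direction.
\<close>

lemma telegraph_recurrence_solution:
  fixes f g :: "nat \<Rightarrow> nat \<Rightarrow> real"
  assumes "\<And>m. f m 0 = 0" "\<And>n. f 0 n = 0"
    and "\<And>m n. f (Suc m) (Suc n) - b * f m (Suc n) - c * f (Suc m) n + b * c * f m n = g m n"
  shows "f m n = (\<Sum>i<m. \<Sum>j<n. b ^ (m - 1 - i) * c ^ (n - 1 - j) * g i j)"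
proof -
  have inner: "f (Suc m) n - b * f m n = (\<Sum>j<n. c ^ (n - 1 - j) * g m j)" for m n
  proof (rule linear_recurrence_solution[where u = "\<lambda>n. f (Suc m) n - b * f m n"])
    show "f (Suc m) (Suc n) - b * f m (Suc n) = c * (f (Suc m) n - b * f m n) + g m n" for n
      using assms(3)[of m n] by (simp add: algebra_simps)
  qed (simp add: assms)
  have "f m n = (\<Sum>i<m. b ^ (m - 1 - i) * (\<Sum>j<n. c ^ (n - 1 - j) * g i j))"
  proof (rule linear_recurrence_solution[where u = "\<lambda>m. f m n"])
    show "f (Suc m) n = b * f m n + (\<Sum>j<n. c ^ (n - 1 - j) * g m j)" for m
      using inner[of m n] by simp
  qed (simp add: assms)
  then show ?thesis by (simp add: sum_distrib_left mult.assoc)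
qed

text \<open>
  Bounding the sum over \<open>i\<close> by \<open>N\<close> times a bound uniform in \<open>i\<close> leaves a one-dimensional Gronwall
  inequality in \<open>n\<close>, whose extremal case is a geometric sum.
\<close>

lemma discrete_gronwall:
  fixes a :: "nat \<Rightarrow> nat \<Rightarrow> real"
  assumes "K \<ge> 0"
    and le: "\<And>m n. m \<le> N \<Longrightarrow> n \<le> N \<Longrightarrow> a m n \<le> \<epsilon> + K * (\<Sum>i<m. \<Sum>j<n. a i j)"
    and "\<epsilon> \<ge> 0" "m \<le> N" "n \<le> N"
  shows "a m n \<le> \<epsilon> * (1 + K * N) ^ n"
  using assms(4,5)
proof (induction n arbitrary: m rule: less_induct)
  case (less n)
  have geo: "K * N * (\<Sum>j<k. (1 + K * N) ^ j) = (1 + K * N) ^ k - 1" for k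
    by (induction k) (simp_all add: algebra_simps)
  have "(\<Sum>i<m. \<Sum>j<n. a i j) \<le> (\<Sum>i<m. \<Sum>j<n. \<epsilon> * (1 + K * N) ^ j)"
    using less by (intro sum_mono less.IH) auto
  also have "\<dots> = real m * (\<Sum>j<n. \<epsilon> * (1 + K * N) ^ j)" by simp
  also have "\<dots> \<le> real N * (\<Sum>j<n. \<epsilon> * (1 + K * N) ^ j)"
    using less assms by (intro mult_right_mono sum_nonneg) auto
  finally have "K * (\<Sum>i<m. \<Sum>j<n. a i j) \<le> K * (real N * (\<Sum>j<n. \<epsilon> * (1 + K * N) ^ j))"
    using assms by (intro mult_left_mono)
  also have "\<dots> = \<epsilon> * (K * N * (\<Sum>j<n. (1 + K * N) ^ j))"
    by (simp add: sum_distrib_left mult_ac)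
  also have "\<dots> = \<epsilon> * (1 + K * N) ^ n - \<epsilon>" unfolding geo by (simp add: algebra_simps)
  finally show ?case using le[of m n] less.prems by linarith
qed

section \<open>Concentration of the observable\<close>

context dynamic_six_vertex
begin

lemma obs_measurable [measurable]: "(\<lambda>\<eta>. obs \<eta> m n) \<in> borel_measurable vertex_noise"
  unfolding obs_def by (rule measurable_compose[OF measurable_height]) simp

lemma obs_bounded: "\<exists>B. \<forall>\<eta>. \<bar>obs \<eta> m n\<bar> \<le> B"
proof -
  have "\<bar>obs \<eta> m n\<bar> \<le> Max ((\<lambda>h. \<bar>height_transform q \<alpha> (real n - real m) (real h)\<bar>) ` {..n})" for \<eta>
    unfolding obs_def by (intro Max_ge) (use height_le in auto)
  then show ?thesis by blast
qed

lemma innovation_measurable [measurable]: "innovation i j \<in> borel_measurable vertex_noise"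
  unfolding innovation_def[abs_def] by measurable

lemma innovation_bounded: "\<exists>B. \<forall>\<eta>. \<bar>innovation i j \<eta>\<bar> \<le> B"
proof -
  obtain B1 B2 B3 B4 where "\<forall>\<eta>. \<bar>obs \<eta> (Suc i) (Suc j)\<bar> \<le> B1" "\<forall>\<eta>. \<bar>obs \<eta> i (Suc j)\<bar> \<le> B2"
    "\<forall>\<eta>. \<bar>obs \<eta> (Suc i) j\<bar> \<le> B3" "\<forall>\<eta>. \<bar>obs \<eta> i j\<bar> \<le> B4"
    using obs_bounded by meson
  note B = this[rule_format]
  have "\<bar>innovation i j \<eta>\<bar> \<le> B1 + \<bar>b\<bar> * B2 + \<bar>b*q\<bar> * B3 + \<bar>1 - b - b*q\<bar> * B4" for \<eta>
  proof -
    have "\<bar>b * obs \<eta> i (Suc j)\<bar> \<le> \<bar>b\<bar> * B2" "\<bar>b*q * obs \<eta> (Suc i) j\<bar> \<le> \<bar>b*q\<bar> * B3"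
      "\<bar>(1 - b - b*q) * obs \<eta> i j\<bar> \<le> \<bar>1 - b - b*q\<bar> * B4"
      using B[of \<eta>] unfolding abs_mult[of b "obs _ _ _"] abs_mult[of "b*q" "obs _ _ _"] abs_mult[of "1 - b - b*q" "obs _ _ _"]
      by (auto intro!: mult_left_mono)
    then show ?thesis unfolding innovation_def using B(1)[of \<eta>] by linarith
  qed
  then show ?thesis by blast
qed

lemma innovation_update:
  assumes "\<not> (fst v \<le> Suc i \<and> snd v \<le> Suc j)"
  shows "innovation i j (\<eta>(v := w)) = innovation i j \<eta>"
proof -
  have "obs (\<eta>(v := w)) m n = obs \<eta> m n" if "m \<le> Suc i" "n \<le> Suc j" for m n
    unfolding obs_def using assms that by (subst height_update) auto
  then show ?thesis by (simp add: innovation_def)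
qed

lemma straight_prob_bounds:
  assumes "min b (b*q) \<le> p" "p \<le> max b (b*q)"
  shows "0 \<le> p" "p \<le> 1" "1 - p \<le> (1 - b) + (1 - b*q)"
proof -
  have "0 < b * q" using b_pos q_pos by simp
  then show "0 \<le> p" "p \<le> 1" "1 - p \<le> (1 - b) + (1 - b*q)"
    using assms b_pos b_less bq_less by (auto simp: min_def max_def split: if_splits)
qed

lemma integral_innovation_resampled: "(\<integral>w. innovation i j (\<eta>((Suc i, Suc j) := w)) \<partial>unif) = 0"
proof -
  obtain p s s' where *: "min b (b*q) \<le> p" "p \<le> max b (b*q)" "p * s + (1 - p) * s' = 0"
    "\<And>w. innovation i j (\<eta>((Suc i, Suc j) := w)) = (if w < p then s else s')"
    by (rule innovation_two_valued[of \<eta> i j]) blast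
  show ?thesis unfolding *(4) using straight_prob_bounds[OF *(1,2)] *(3)
    by (simp add: integral_unif_two_valued)
qed

lemma expectation_mult_innovation:
  assumes g: "g \<in> borel_measurable vertex_noise" "\<exists>B. \<forall>\<eta>. \<bar>g \<eta>\<bar> \<le> B"
    and upd: "\<And>\<eta> w. g (\<eta>((Suc i, Suc j) := w)) = g \<eta>"
  shows "(\<integral>\<eta>. g \<eta> * innovation i j \<eta> \<partial>vertex_noise) = 0"
proof -
  obtain B where "\<And>\<eta>. \<bar>g \<eta> * innovation i j \<eta>\<bar> \<le> B"
    using bounded_mult[OF g(2) innovation_bounded[of i j]] by blast
  then have "(\<integral>\<eta>. g \<eta> * innovation i j \<eta> \<partial>vertex_noise) =
      (\<integral>\<eta>. (\<integral>w. g (\<eta>((Suc i, Suc j) := w)) * innovation i j (\<eta>((Suc i, Suc j) := w)) \<partial>unif) \<partial>vertex_noise)"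
    by (intro integral_resample) (use g(1) in auto)
  then show ?thesis by (simp add: upd integral_innovation_resampled)
qed

lemma expectation_innovation: "(\<integral>\<eta>. innovation i j \<eta> \<partial>vertex_noise) = 0"
  using expectation_mult_innovation[of "\<lambda>_. 1" i j] by auto

text \<open>
  Of two distinct vertices, one is not weakly below and to the left of the other. The innovation at the
  other one does not depend on the sample at the first, while the innovation at the first averages to
  zero over its own sample.
\<close>

lemma innovation_orthogonal:
  assumes "(i, j) \<noteq> (i', j')"
  shows "(\<integral>\<eta>. innovation i j \<eta> * innovation i' j' \<eta> \<partial>vertex_noise) = 0"
proof (cases "i \<le> i' \<and> j \<le> j'")
  case True
  then have "(\<integral>\<eta>. innovation i j \<eta> * innovation i' j' \<eta> \<partial>vertex_noise) = 0"
    using assms by (intro expectation_mult_innovation innovation_bounded innovation_update) auto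
  then show ?thesis .
next
  case False
  then have "(\<integral>\<eta>. innovation i' j' \<eta> * innovation i j \<eta> \<partial>vertex_noise) = 0"
    by (intro expectation_mult_innovation innovation_bounded innovation_update) auto
  then show ?thesis by (simp add: mult.commute)
qed

text \<open>
  A centred variable with values \<open>s\<close> and \<open>s'\<close>, taken with probabilities \<open>p\<close> and \<open>1 - p\<close>, has variance
  \<open>p (1 - p) (s - s')^2\<close>. The gain over the trivial bound \<open>(s - s')^2\<close> is the turning probability
  \<open>1 - p\<close>, which is at most \<open>(1 - b) + (1 - bq)\<close>.
\<close>

lemma expectation_innovation_square_le:
  assumes K: "\<And>A. A \<le> j \<Longrightarrow> q powr real A + \<alpha> * q powr (real j - real i - real A) \<le> K"
  shows "(\<integral>\<eta>. (innovation i j \<eta>)\<^sup>2 \<partial>vertex_noise) \<le> ((1 - b) + (1 - b*q)) * (\<bar>1 - q\<bar> * (1 + 1/q) * K)\<^sup>2"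
    (is "_ \<le> ?R")
proof -
  have R0: "0 \<le> (1 - b) + (1 - b*q)" using b_less bq_less by simp
  obtain B where B: "\<And>\<eta>. \<bar>(innovation i j \<eta>)\<^sup>2\<bar> \<le> B"
    using bounded_mult[OF innovation_bounded innovation_bounded, of i j i j] by (auto simp: power2_eq_square)
  have inner: "(\<integral>w. (innovation i j (\<eta>((Suc i, Suc j) := w)))\<^sup>2 \<partial>unif) \<le> ?R" for \<eta>
  proof -
    define A where "A = height b q \<alpha> \<eta> (Suc i) j"
    obtain p s s' where *: "min b (b*q) \<le> p" "p \<le> max b (b*q)" "p * s + (1 - p) * s' = 0"
      "\<bar>s - s'\<bar> \<le> \<bar>1 - q\<bar> * (1 + 1/q) * (q powr real A + \<alpha> * q powr (real j - real i - real A))"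
      "\<And>w. innovation i j (\<eta>((Suc i, Suc j) := w)) = (if w < p then s else s')"
      unfolding A_def by (rule innovation_two_valued[of \<eta> i j]) blast
    note p = straight_prob_bounds[OF *(1,2)]
    have "A \<le> j" by (simp add: A_def height_le)
    then have "\<bar>s - s'\<bar> \<le> \<bar>1 - q\<bar> * (1 + 1/q) * K"
      using *(4) K[of A] q_pos by (intro order_trans[OF *(4)] mult_left_mono) auto
    then have ss: "(s - s')\<^sup>2 \<le> (\<bar>1 - q\<bar> * (1 + 1/q) * K)\<^sup>2"
      using power_mono[of "\<bar>s - s'\<bar>" _ 2] by simp
    have "(\<integral>w. (innovation i j (\<eta>((Suc i, Suc j) := w)))\<^sup>2 \<partial>unif) = p * s\<^sup>2 + (1 - p) * s'\<^sup>2"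
      unfolding *(5) using integral_unif_two_valued[OF p(1,2), of "s\<^sup>2" "s'\<^sup>2"]
      by (simp add: if_distrib[of "\<lambda>x. x\<^sup>2"])
    \<comment> \<open>variance plus squared mean; the latter vanishes\<close>
    also have "\<dots> = p * ((1 - p) * (s - s')\<^sup>2) + (p * s + (1 - p) * s')\<^sup>2"
      by (simp add: power2_eq_square algebra_simps)
    also have "\<dots> \<le> 1 * (((1 - b) + (1 - b*q)) * (\<bar>1 - q\<bar> * (1 + 1/q) * K)\<^sup>2) + 0"
      using p ss R0 *(3) by (intro add_mono mult_mono) auto
    finally show ?thesis by simp
  qed
  have "(\<integral>\<eta>. (innovation i j \<eta>)\<^sup>2 \<partial>vertex_noise) =
      (\<integral>\<eta>. (\<integral>w. (innovation i j (\<eta>((Suc i, Suc j) := w)))\<^sup>2 \<partial>unif) \<partial>vertex_noise)"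
    by (rule integral_resample[OF _ B]) measurable
  also have "\<dots> \<le> ?R"
  proof (cases "integrable vertex_noise (\<lambda>\<eta>. \<integral>w. (innovation i j (\<eta>((Suc i, Suc j) := w)))\<^sup>2 \<partial>unif)")
    case True
    then show ?thesis by (rule vertex_noise.integral_le_const) (use inner in auto)
  next
    case False
    then show ?thesis using R0 by (simp add: not_integrable_integral_eq)
  qed
  finally show ?thesis .
qed

definition mean :: "nat \<Rightarrow> nat \<Rightarrow> real" where
  "mean m n = (\<integral>\<eta>. obs \<eta> m n \<partial>vertex_noise)"

lemma obs_boundary: "obs \<eta> m 0 = 0" "obs \<eta> 0 n = (q powr real n - 1) * (1 + \<alpha>)"
  using q_pos by (simp_all add: obs_def height_transform_def)

lemma mean_boundary: "mean m 0 = 0" "mean 0 n = (q powr real n - 1) * (1 + \<alpha>)"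
  by (simp_all add: mean_def obs_boundary vertex_noise.prob_space)

lemma obs_integrable: "integrable vertex_noise (\<lambda>\<eta>. obs \<eta> m n)"
  by (intro bounded_integrable obs_bounded) measurable

lemma mean_recurrence:
  "mean (Suc m) (Suc n) = b * mean m (Suc n) + b * q * mean (Suc m) n + (1 - b - b * q) * mean m n"
proof -
  have "0 = (\<integral>\<eta>. innovation m n \<eta> \<partial>vertex_noise)" by (simp add: expectation_innovation)
  also have "\<dots> = mean (Suc m) (Suc n) - b * mean m (Suc n) - b * q * mean (Suc m) n - (1 - b - b * q) * mean m n"
    unfolding innovation_def mean_def using obs_integrable by simp
  finally show ?thesis by simp
qed

text \<open>
  The deviation \<open>R\<close> of the observable from its mean solves
  \<open>(A - b) (B - bq) R = (1 - b) (1 - bq) R + innovation\<close> with zero boundary values, where \<open>A\<close> and \<open>B\<close> are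
  the unit shifts. Inverting the left-hand side splits \<open>R\<close> into a weighted sum of orthogonal
  innovations, which is controlled in mean square, and a feedback term of total weight
  \<open>O((1 - b) (1 - bq) N^2)\<close>, which is handled by the Gronwall inequality for first moments.
\<close>

theorem obs_concentration:
  assumes "m \<le> N" "n \<le> N"
    and K: "\<And>i j A. i < N \<Longrightarrow> j < N \<Longrightarrow> A \<le> j \<Longrightarrow> q powr real A + \<alpha> * q powr (real j - real i - real A) \<le> K"
  shows "(\<integral>\<eta>. \<bar>obs \<eta> m n - mean m n\<bar> \<partial>vertex_noise)
     \<le> real N * sqrt ((1 - b) + (1 - b*q)) * \<bar>\<bar>1 - q\<bar> * (1 + 1/q) * K\<bar> * (1 + (1 - b) * (1 - b*q) * N) ^ n"
proof -
  define c where "c = b * q"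
  have c: "0 < c" "c < 1" using b_pos q_pos bq_less by (auto simp: c_def)
  define \<delta> where "\<delta> = (1 - b) + (1 - b*q)"
  define D where "D = \<bar>1 - q\<bar> * (1 + 1/q) * K"
  have \<delta>: "\<delta> \<ge> 0" using b_less bq_less by (simp add: \<delta>_def)
  define R where "R m n \<eta> = obs \<eta> m n - mean m n" for m n \<eta>
  define S where "S m n \<eta> = (\<Sum>p\<in>{..<m} \<times> {..<n}. (b ^ (m - 1 - fst p) * c ^ (n - 1 - snd p)) * innovation (fst p) (snd p) \<eta>)"
    for m n \<eta>
  have Rint: "integrable vertex_noise (R m n)" for m n
    unfolding R_def[abs_def] using obs_integrable by simp
  have nint: "integrable vertex_noise (\<lambda>\<eta>. innovation i j \<eta> * innovation i' j' \<eta>)" for i j i' j'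
    by (intro bounded_integrable bounded_mult innovation_bounded) measurable
  have nint1: "integrable vertex_noise (innovation i j)" for i j
    by (intro bounded_integrable innovation_bounded) measurable
  have Sint: "integrable vertex_noise (S m n)" for m n
    unfolding S_def[abs_def] using nint1 by simp
  have S2int: "integrable vertex_noise (\<lambda>\<eta>. (S m n \<eta>)\<^sup>2)" for m n
  proof -
    have "integrable vertex_noise (\<lambda>\<eta>. \<Sum>p\<in>{..<m} \<times> {..<n}. \<Sum>p'\<in>{..<m} \<times> {..<n}. 
       ((b ^ (m - 1 - fst p) * c ^ (n - 1 - snd p)) * (b ^ (m - 1 - fst p') * c ^ (n - 1 - snd p'))) *
        (innovation (fst p) (snd p) \<eta> * innovation (fst p') (snd p') \<eta>))"
      using nint by simp
    then show ?thesis
      unfolding S_def power2_eq_square sum_product by (simp add: mult_ac)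
  qed
  have wt: "0 \<le> b ^ k * c ^ l" "b ^ k * c ^ l \<le> 1" for k l
    using b_pos b_less c by (auto intro!: mult_le_one power_le_one)
  have S_bound: "(\<integral>\<eta>. \<bar>S m n \<eta>\<bar> \<partial>vertex_noise) \<le> real N * sqrt \<delta> * \<bar>D\<bar>" if "m \<le> N" "n \<le> N" for m n
  proof -
    have "(\<integral>\<eta>. (S m n \<eta>)\<^sup>2 \<partial>vertex_noise) = 
      (\<Sum>p\<in>{..<m} \<times> {..<n}. (b ^ (m - 1 - fst p) * c ^ (n - 1 - snd p))\<^sup>2 * (\<integral>\<eta>. (innovation (fst p) (snd p) \<eta>)\<^sup>2 \<partial>vertex_noise))"
      unfolding S_def
      by (rule vertex_noise.expectation_square_orthogonal_sum) (auto intro: nint intro!: innovation_orthogonal)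
    also have "\<dots> \<le> (\<Sum>p\<in>{..<m} \<times> {..<n}. 1 * (\<delta> * D\<^sup>2))"
    proof (intro sum_mono mult_mono)
      fix p assume "p \<in> {..<m} \<times> {..<n}"
      then show "(\<integral>\<eta>. (innovation (fst p) (snd p) \<eta>)\<^sup>2 \<partial>vertex_noise) \<le> \<delta> * D\<^sup>2"
        unfolding \<delta>_def D_def using that by (intro expectation_innovation_square_le K) auto
    qed (use wt in \<open>auto intro!: power_le_one\<close>)
    also have "\<dots> = real (m * n) * (\<delta> * D\<^sup>2)" by simp
    also have "\<dots> \<le> real (N * N) * (\<delta> * D\<^sup>2)"
      using that \<delta> by (intro mult_right_mono of_nat_mono mult_le_mono) auto
    finally have "(\<integral>\<eta>. (S m n \<eta>)\<^sup>2 \<partial>vertex_noise) \<le> real (N * N) * (\<delta> * D\<^sup>2)" .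
    then have "sqrt (\<integral>\<eta>. (S m n \<eta>)\<^sup>2 \<partial>vertex_noise) \<le> sqrt (real (N * N) * (\<delta> * D\<^sup>2))"
      by simp
    also have "\<dots> = real N * sqrt \<delta> * \<bar>D\<bar>" by (simp add: real_sqrt_mult)
    finally show ?thesis
      using vertex_noise.expectation_abs_le_sqrt[OF Sint S2int, of m n] by linarith
  qed
  define k where "k = (1 - b) * (1 - c)"
  have k: "k \<ge> 0" using b_less c by (simp add: k_def)
  have R_eq: "R m n \<eta> = S m n \<eta> + k * (\<Sum>i<m. \<Sum>j<n. (b ^ (m - 1 - i) * c ^ (n - 1 - j)) * R i j \<eta>)" for m n \<eta>
  proof -
    have "R m n \<eta> = (\<Sum>i<m. \<Sum>j<n. b ^ (m - 1 - i) * c ^ (n - 1 - j) * (innovation i j \<eta> + k * R i j \<eta>))"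
    proof (rule telegraph_recurrence_solution[where f = "\<lambda>m n. R m n \<eta>"])
      show "R (Suc m) (Suc n) \<eta> - b * R m (Suc n) \<eta> - c * R (Suc m) n \<eta> + b * c * R m n \<eta> =
         innovation m n \<eta> + k * R m n \<eta>" for m n
        unfolding R_def mean_recurrence innovation_def k_def c_def by (simp add: algebra_simps)
    qed (simp_all add: R_def obs_boundary mean_boundary)
    then show ?thesis
      unfolding S_def by (simp add: sum.cartesian_product' sum.distrib sum_distrib_left algebra_simps case_prod_beta)
  qed
  define a where "a m n = (\<integral>\<eta>. \<bar>R m n \<eta>\<bar> \<partial>vertex_noise)" for m n
  have "a m n \<le> real N * sqrt \<delta> * \<bar>D\<bar> + k * (\<Sum>i<m. \<Sum>j<n. a i j)" if "m \<le> N" "n \<le> N" for m n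
  proof -
    have "\<bar>R m n \<eta>\<bar> \<le> \<bar>S m n \<eta>\<bar> + k * (\<Sum>i<m. \<Sum>j<n. \<bar>R i j \<eta>\<bar>)" for \<eta>
    proof -
      have "\<bar>\<Sum>i<m. \<Sum>j<n. (b ^ (m - 1 - i) * c ^ (n - 1 - j)) * R i j \<eta>\<bar> \<le> (\<Sum>i<m. \<Sum>j<n. \<bar>R i j \<eta>\<bar>)"
      proof (intro order_trans[OF sum_abs] sum_mono)
        fix i j
        have "(b ^ (m - 1 - i) * c ^ (n - 1 - j)) * \<bar>R i j \<eta>\<bar> \<le> 1 * \<bar>R i j \<eta>\<bar>"
          by (intro mult_right_mono wt) auto
        then show "\<bar>(b ^ (m - 1 - i) * c ^ (n - 1 - j)) * R i j \<eta>\<bar> \<le> \<bar>R i j \<eta>\<bar>"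
          unfolding abs_mult[of "_ * _" "R i j \<eta>"] using wt(1)[of "m-1-i" "n-1-j"] by simp
      qed
      then have "k * \<bar>\<Sum>i<m. \<Sum>j<n. (b ^ (m - 1 - i) * c ^ (n - 1 - j)) * R i j \<eta>\<bar> \<le> k * (\<Sum>i<m. \<Sum>j<n. \<bar>R i j \<eta>\<bar>)"
        using k by (intro mult_left_mono)
      moreover have "\<bar>R m n \<eta>\<bar> \<le> \<bar>S m n \<eta>\<bar> + \<bar>k * (\<Sum>i<m. \<Sum>j<n. (b ^ (m - 1 - i) * c ^ (n - 1 - j)) * R i j \<eta>)\<bar>"
        unfolding R_eq[of m n \<eta>] by (rule abs_triangle_ineq)
      ultimately show ?thesis using k by (simp add: abs_mult)
    qed
    then have "a m n \<le> (\<integral>\<eta>. \<bar>S m n \<eta>\<bar> + k * (\<Sum>i<m. \<Sum>j<n. \<bar>R i j \<eta>\<bar>) \<partial>vertex_noise)"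
      unfolding a_def using Rint Sint by (intro integral_mono) auto
    also have "\<dots> = (\<integral>\<eta>. \<bar>S m n \<eta>\<bar> \<partial>vertex_noise) + k * (\<Sum>i<m. \<Sum>j<n. a i j)"
      unfolding a_def using Rint Sint by simp
    finally show ?thesis using S_bound[OF that] by simp
  qed
  then have "a m n \<le> real N * sqrt \<delta> * \<bar>D\<bar> * (1 + k * N) ^ n"
    using assms k \<delta> by (intro discrete_gronwall[of k N]) auto
  then show ?thesis by (simp add: a_def R_def \<delta>_def D_def k_def c_def)
qed

end

section \<open>Contour integral for the mean of the observable\<close>

text \<open>
  The product solution \<open>A^m B^n\<close> of the telegraph equation, divided by \<open>z\<close>. With \<open>\<kappa> = (1 - b) (1 - \<sigma>)\<close>,
  \<open>\<mu> = q - 1\<close> and \<open>\<sigma> = q (1 - b) / (1 - bq)\<close> one has \<open>A - b = (1 - b) (1 + z) / (1 + \<sigma> z)\<close> and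
  \<open>B - bq = (1 - bq) (1 + \<sigma> z) / (1 + z)\<close>, whose product is constant. The form \<open>1 + \<kappa> (...)\<close> used here
  displays the small quantity in the limit.
\<close>

definition plane_wave :: "real \<Rightarrow> real \<Rightarrow> real \<Rightarrow> nat \<Rightarrow> nat \<Rightarrow> complex \<Rightarrow> complex" where
  "plane_wave \<sigma> \<kappa> \<mu> m n z =
     (1 + of_real \<kappa> * (z / (1 + of_real \<sigma> * z))) ^ m * (1 + of_real \<mu> * (z / (1 + z))) ^ n / z"

lemma zero_notin_cball: "r < 1 \<Longrightarrow> (0::complex) \<notin> cball (- 1) r"
  by (simp add: dist_norm)

lemma denominator_nonzero:
  assumes "\<bar>1 - 1 / \<sigma>\<bar> > r" "\<sigma> \<noteq> 0" "z \<in> cball (- 1) r"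
  shows "1 + complex_of_real \<sigma> * z \<noteq> 0"
proof
  assume "1 + complex_of_real \<sigma> * z = 0"
  then have "z = of_real (- 1 / \<sigma>)"
    using assms(2) by (simp add: field_simps eq_neg_iff_add_eq_0 add.commute)
  then have "dist (- 1) z = norm (of_real (1 / \<sigma> - 1) :: complex)"
    unfolding dist_norm by simp
  also have "\<dots> = \<bar>1 / \<sigma> - 1\<bar>" by (rule norm_of_real)
  finally show False using assms by (simp add: abs_minus_commute)
qed

text \<open>
  At infinity the integrand behaves like \<open>q^n / z^(k + 1)\<close> and its only pole is \<open>-1\<close>, so only \<open>k = 0\<close>
  contributes. Carrying all \<open>k\<close> makes the induction on \<open>n\<close> close.
\<close>

lemma has_contour_integral_power_over_pole:
  assumes "r > 0"
  shows "((\<lambda>z. (q + (1 - q) / (1 + z)) ^ n / (1 + z) ^ Suc k) has_contour_integral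
           (if k = 0 then 2 * of_real pi * \<i> * q ^ n else 0)) (circlepath (- 1) r)"
proof (induction n arbitrary: k)
  case 0
  show ?case
    using Cauchy_has_contour_integral_higher_derivative_circlepath[of "- 1" r "\<lambda>_. 1" "- 1" k] assms
    by (cases "k = 0") (simp_all add: add.commute)
next
  case (Suc n)
  have "((\<lambda>z. q * ((q + (1 - q) / (1 + z)) ^ n / (1 + z) ^ Suc k) +
        (1 - q) * ((q + (1 - q) / (1 + z)) ^ n / (1 + z) ^ Suc (Suc k))) has_contour_integral
     q * (if k = 0 then 2 * of_real pi * \<i> * q ^ n else 0) + (1 - q) * (if Suc k = 0 then 2 * of_real pi * \<i> * q ^ n else 0))
     (circlepath (- 1) r)"
    by (intro has_contour_integral_add has_contour_integral_lmul Suc)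
  then have "((\<lambda>z. q * ((q + (1 - q) / (1 + z)) ^ n / (1 + z) ^ Suc k) +
        (1 - q) * ((q + (1 - q) / (1 + z)) ^ n / (1 + z) ^ Suc (Suc k))) has_contour_integral
     (if k = 0 then 2 * of_real pi * \<i> * q ^ Suc n else 0)) (circlepath (- 1) r)"
    by (simp add: mult_ac split: if_splits)
  then show ?case
  proof (rule has_contour_integral_eq)
    fix z :: complex
    define w where "w = q + (1 - q) / (1 + z)"
    have "w ^ Suc n = q * w ^ n + (1 - q) / (1 + z) * w ^ n"
      by (simp add: w_def distrib_right)
    then show "q * ((q + (1 - q) / (1 + z)) ^ n / (1 + z) ^ Suc k) +
        (1 - q) * ((q + (1 - q) / (1 + z)) ^ n / (1 + z) ^ Suc (Suc k)) =
        (q + (1 - q) / (1 + z)) ^ Suc n / (1 + z) ^ Suc k"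
      unfolding w_def[symmetric] by (simp add: add_divide_distrib mult.commute)
  qed
qed

lemma plane_wave_contour_integrable:
  assumes "0 < r" "r < 1" "\<bar>1 - 1 / \<sigma>\<bar> > r" "\<sigma> \<noteq> 0"
  shows "plane_wave \<sigma> \<kappa> \<mu> m n contour_integrable_on circlepath (- 1) r"
proof (rule contour_integrable_continuous_circlepath)
  have "z \<noteq> 0 \<and> 1 + z \<noteq> 0 \<and> 1 + complex_of_real \<sigma> * z \<noteq> 0" if "z \<in> sphere (- 1) r" for z
    using that assms denominator_nonzero[OF assms(3,4), of z] zero_notin_cball[of r]
    by (auto simp: add_eq_0_iff)
  then show "continuous_on (path_image (circlepath (- 1) r)) (plane_wave \<sigma> \<kappa> \<mu> m n)"
    unfolding plane_wave_def[abs_def] using assms by (auto intro!: continuous_intros)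
qed

lemma plane_wave_integral_no_pole:
  assumes "0 < r" "r < 1" "\<bar>1 - 1 / \<sigma>\<bar> > r" "\<sigma> \<noteq> 0"
  shows "contour_integral (circlepath (- 1) r) (plane_wave \<sigma> \<kappa> \<mu> m 0) = 0"
proof (rule contour_integral_unique, rule Cauchy_theorem_convex_simple)
  show "plane_wave \<sigma> \<kappa> \<mu> m 0 holomorphic_on cball (- 1) r"
    unfolding plane_wave_def[abs_def]
    using denominator_nonzero[OF assms(3,4)] zero_notin_cball[OF assms(2)] assms
    by (auto intro!: holomorphic_intros)
qed (use assms in auto)

text \<open>
  Since \<open>B - 1 = (q - 1) z / (1 + z)\<close>, raising \<open>n\<close> by one changes the integral by \<open>(q - 1)\<close> times the
  integral of \<open>B^n / (1 + z)\<close>, which has no pole at \<open>0\<close> and equals \<open>2 \<pi> i q^n\<close>.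
\<close>

lemma plane_wave_integral_first_column:
  assumes "0 < r" "r < 1"
  shows "contour_integral (circlepath (- 1) r) (plane_wave \<sigma> \<kappa> (q - 1) 0 n) =
    2 * of_real pi * \<i> * (of_real q ^ n - 1)"
proof (induction n)
  case 0
  have "contour_integral (circlepath (- 1) r) (plane_wave \<sigma> \<kappa> (q - 1) 0 0) =
      contour_integral (circlepath (- 1) r) (plane_wave 1 0 0 0 0)"
    by (intro contour_integral_eq) (simp add: plane_wave_def)
  also have "\<dots> = 0"
  proof (rule contour_integral_unique, rule Cauchy_theorem_convex_simple)
    show "plane_wave 1 0 0 0 0 holomorphic_on cball (- 1) r"
      unfolding plane_wave_def[abs_def] using zero_notin_cball[OF assms(2)]
      by (auto intro!: holomorphic_intros)
  qed (use assms in auto)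
  finally show ?case by simp
next
  case (Suc n)
  define B where "B z = complex_of_real q + (1 - of_real q) / (1 + z)" for z
  have nz: "z \<noteq> 0 \<and> 1 + z \<noteq> 0" if "z \<in> path_image (circlepath (- 1) r)" for z
    using that assms zero_notin_cball[of r] by (auto simp: add_eq_0_iff)
  have B: "1 + complex_of_real (q - 1) * (z / (1 + z)) = B z" if "1 + z \<noteq> 0" for z
    using that by (simp add: B_def field_simps)
  have int: "plane_wave \<sigma> \<kappa> (q - 1) 0 n contour_integrable_on circlepath (- 1) r"
  proof (rule contour_integrable_continuous_circlepath)
    show "continuous_on (path_image (circlepath (- 1) r)) (plane_wave \<sigma> \<kappa> (q - 1) 0 n)"
      unfolding plane_wave_def[abs_def] using nz assms by (auto intro!: continuous_intros)
  qed
  have pole: "((\<lambda>z. B z ^ n / (1 + z)) has_contour_integral 2 * of_real pi * \<i> * of_real q ^ n) (circlepath (- 1) r)"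
    using has_contour_integral_power_over_pole[OF assms(1), of "of_real q" n 0] by (simp add: B_def)
  have "contour_integral (circlepath (- 1) r) (plane_wave \<sigma> \<kappa> (q - 1) 0 (Suc n)) =
    contour_integral (circlepath (- 1) r) (\<lambda>z. plane_wave \<sigma> \<kappa> (q - 1) 0 n z + of_real (q - 1) * (B z ^ n / (1 + z)))"
  proof (rule contour_integral_eq)
    fix z assume "z \<in> path_image (circlepath (- 1) r)"
    then have z: "z \<noteq> 0" "1 + z \<noteq> 0" using nz by auto
    have pw: "plane_wave \<sigma> \<kappa> (q - 1) 0 k z = B z ^ k / z" for k
      unfolding plane_wave_def B[OF z(2)] by simp
    have "plane_wave \<sigma> \<kappa> (q - 1) 0 (Suc n) z = B z ^ n * (1 + complex_of_real (q - 1) * (z / (1 + z))) / z"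
      unfolding pw B[OF z(2)] by simp
    also have "\<dots> = plane_wave \<sigma> \<kappa> (q - 1) 0 n z + of_real (q - 1) * (B z ^ n / (1 + z))"
      unfolding pw using z by (simp add: divide_simps) (simp add: algebra_simps)
    finally show "plane_wave \<sigma> \<kappa> (q - 1) 0 (Suc n) z = plane_wave \<sigma> \<kappa> (q - 1) 0 n z + of_real (q - 1) * (B z ^ n / (1 + z))" .
  qed
  also have "\<dots> = 2 * of_real pi * \<i> * (of_real q ^ n - 1) + of_real (q - 1) * (2 * of_real pi * \<i> * of_real q ^ n)"
    using has_contour_integral_add[OF has_contour_integral_integral[OF int] has_contour_integral_lmul[OF pole, of "of_real (q - 1)"]]
    unfolding Suc by (rule contour_integral_unique)
  finally show ?case by (simp add: algebra_simps)
qed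

context dynamic_six_vertex
begin

definition \<sigma> :: real where "\<sigma> = q * (1 - b) / (1 - b * q)"

lemma \<sigma>_pos: "\<sigma> > 0"
  unfolding \<sigma>_def using q_pos b_less bq_less by simp

lemma plane_wave_recurrence:
  fixes z :: complex
  assumes "1 + z \<noteq> 0" "1 + of_real \<sigma> * z \<noteq> 0"
  shows "plane_wave \<sigma> ((1 - b) * (1 - \<sigma>)) (q - 1) (Suc m) (Suc n) z =
     of_real b * plane_wave \<sigma> ((1 - b) * (1 - \<sigma>)) (q - 1) m (Suc n) z
     + of_real (b * q) * plane_wave \<sigma> ((1 - b) * (1 - \<sigma>)) (q - 1) (Suc m) n z
     + of_real (1 - b - b * q) * plane_wave \<sigma> ((1 - b) * (1 - \<sigma>)) (q - 1) m n z"
proof -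
  define A where "A = 1 + of_real ((1 - b) * (1 - \<sigma>)) * (z / (1 + of_real \<sigma> * z))"
  define B where "B = 1 + complex_of_real (q - 1) * (z / (1 + z))"
  have "(1 - b * q) * \<sigma> = q * (1 - b)" using bq_less by (simp add: \<sigma>_def)
  then have sg: "(1 - of_real b * of_real q) * complex_of_real \<sigma> = of_real q * (1 - of_real b)"
    by (metis of_real_1 of_real_diff of_real_mult)
  have A: "(A - of_real b) * (1 + of_real \<sigma> * z) = (1 - of_real b) * (1 + z)"
    using assms by (simp add: A_def field_simps)
  have "(B - of_real (b * q)) * (1 + z) = (1 - of_real b * of_real q) + of_real q * (1 - of_real b) * z"
    using assms by (simp add: B_def field_simps)
  also have "\<dots> = (1 - of_real b * of_real q) * (1 + of_real \<sigma> * z)"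
    unfolding sg[symmetric] by (simp add: algebra_simps)
  finally have B: "(B - of_real (b * q)) * (1 + z) = (1 - of_real b * of_real q) * (1 + of_real \<sigma> * z)" .
  have "((A - of_real b) * (B - of_real (b * q))) * ((1 + of_real \<sigma> * z) * (1 + z)) =
      ((A - of_real b) * (1 + of_real \<sigma> * z)) * ((B - of_real (b * q)) * (1 + z))"
    by (simp only: mult_ac)
  also have "\<dots> = ((1 - of_real b) * (1 - of_real b * of_real q)) * ((1 + of_real \<sigma> * z) * (1 + z))"
    unfolding A B by (simp only: mult_ac)
  finally have "(A - of_real b) * (B - of_real (b * q)) = (1 - of_real b) * (1 - of_real b * of_real q)"
    using assms by simp
  then have AB: "A * B = of_real b * B + of_real (b * q) * A + of_real (1 - b - b * q)"
    by (simp add: algebra_simps)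
  have "A ^ Suc m * B ^ Suc n = A ^ m * B ^ n * (A * B)" by simp
  also have "\<dots> = of_real b * (A ^ m * B ^ Suc n) + of_real (b * q) * (A ^ Suc m * B ^ n)
      + of_real (1 - b - b * q) * (A ^ m * B ^ n)"
    unfolding AB by (simp add: algebra_simps)
  finally show ?thesis
    unfolding plane_wave_def A_def[symmetric] B_def[symmetric] by (simp add: add_divide_distrib)
qed

text \<open>
  Both sides solve the telegraph equation and agree on the two axes, which determines them everywhere.
  On the horizontal axis the integrand has no pole inside the circle.
\<close>

theorem mean_contour_integral:
  assumes r: "0 < r" "r < 1" "\<bar>1 - 1 / \<sigma>\<bar> > r"
  shows "of_real (mean m n) = (1 + of_real \<alpha>) / (2 * of_real pi * \<i>) *
    contour_integral (circlepath (- 1) r) (plane_wave \<sigma> ((1 - b) * (1 - \<sigma>)) (q - 1) m n)"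
proof -
  define G where "G m n = contour_integral (circlepath (- 1) r) (plane_wave \<sigma> ((1 - b) * (1 - \<sigma>)) (q - 1) m n)" for m n
  have s0: "\<sigma> \<noteq> 0" using \<sigma>_pos by simp
  note int = plane_wave_contour_integrable[OF r s0, of "(1 - b) * (1 - \<sigma>)" "q - 1"]
  have rec: "G (Suc m) (Suc n) = of_real b * G m (Suc n) + of_real (b * q) * G (Suc m) n + of_real (1 - b - b * q) * G m n" for m n
  proof -
    have "G (Suc m) (Suc n) = contour_integral (circlepath (- 1) r)
        (\<lambda>z. of_real b * plane_wave \<sigma> ((1 - b) * (1 - \<sigma>)) (q - 1) m (Suc n) z
     + of_real (b * q) * plane_wave \<sigma> ((1 - b) * (1 - \<sigma>)) (q - 1) (Suc m) n z
     + of_real (1 - b - b * q) * plane_wave \<sigma> ((1 - b) * (1 - \<sigma>)) (q - 1) m n z)"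
      unfolding G_def
    proof (intro contour_integral_eq plane_wave_recurrence)
      fix z assume "z \<in> path_image (circlepath (- 1) r)"
      then show "1 + z \<noteq> 0" "1 + of_real \<sigma> * z \<noteq> 0"
        using r denominator_nonzero[OF r(3) s0, of z] by (auto simp: add_eq_0_iff)
    qed
    also have "\<dots> = of_real b * G m (Suc n) + of_real (b * q) * G (Suc m) n + of_real (1 - b - b * q) * G m n"
      unfolding G_def
      by (intro contour_integral_unique has_contour_integral_add has_contour_integral_lmul has_contour_integral_integral int)
    finally show ?thesis .
  qed
  have G0: "G m 0 = 0" for m
    unfolding G_def by (rule plane_wave_integral_no_pole[OF r s0])
  have G1: "G 0 n = 2 * of_real pi * \<i> * (of_real q ^ n - 1)" for n
    unfolding G_def by (rule plane_wave_integral_first_column[OF r(1,2)])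
  define C where "C = (1 + complex_of_real \<alpha>) / (2 * of_real pi * \<i>)"
  have "of_real (mean m n) = C * G m n"
  proof (induction m arbitrary: n)
    case 0
    have div: "a / c * (c * w) = a * w" if "c \<noteq> 0" for a c w :: complex
      using that by simp
    have nz: "2 * of_real pi * \<i> \<noteq> (0::complex)" by simp
    show ?case
      unfolding G1 C_def mean_boundary div[OF nz] using q_pos by (simp add: powr_realpow mult.commute)
  next
    case (Suc m)
    show ?case
    proof (induction n)
      case 0
      show ?case by (simp add: G0 mean_boundary)
    next
      case (Suc n)
      show ?case
        unfolding mean_recurrence rec of_real_add of_real_mult[of _ "mean _ _"] Suc.IH \<open>\<And>n. of_real (mean m n) = _\<close>
        by (simp add: algebra_simps)
    qed
  qed
  then show ?thesis by (simp add: G_def C_def)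
qed

end

section \<open>Uniform convergence of the integrand\<close>

lemma norm_power_diff_le:
  fixes u v :: complex
  assumes "norm u \<le> R" "norm v \<le> R" "R > 0"
  shows "norm (u ^ k - v ^ k) \<le> k * R ^ (k - 1) * norm (u - v)"
proof (cases k)
  case (Suc l)
  have "norm ((u / of_real R) ^ k - (v / of_real R) ^ k) \<le> k * norm (u / of_real R - v / of_real R)"
    by (rule norm_power_diff) (use assms in \<open>auto simp: norm_divide\<close>)
  moreover have "(u / of_real R) ^ k - (v / of_real R) ^ k = (u ^ k - v ^ k) / of_real (R ^ k)"
    by (simp add: power_divide diff_divide_distrib)
  moreover have "u / of_real R - v / of_real R = (u - v) / of_real R" by (simp add: diff_divide_distrib)
  ultimately have "norm (u ^ k - v ^ k) / R ^ k \<le> k * (norm (u - v) / R)"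
    using assms by (simp add: norm_divide norm_power)
  then show ?thesis using assms Suc by (simp add: field_simps)
qed simp

text \<open>
  Telescoping the difference of the \<open>k\<close>-th powers of \<open>1 + w\<close> and \<open>exp w\<close>, both of which are bounded by
  \<open>exp (norm w)\<close>, and using that the bases differ by a second-order term. For \<open>k w = O(1)\<close> the bound is
  \<open>O(1/k)\<close>.
\<close>

lemma norm_one_plus_power_minus_exp_le:
  fixes w :: complex
  assumes "k > 0"
  shows "norm ((1 + w) ^ k - exp (of_nat k * w)) \<le> exp (k * norm w) * (k * norm w)\<^sup>2 / k"
proof -
  have "norm (1 + w) \<le> 1 + norm w" by (metis norm_one norm_triangle_ineq)
  also have "\<dots> \<le> exp (norm w)" by (rule exp_ge_add_one_self)
  finally have R1: "norm (1 + w) \<le> exp (norm w)" .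
  have R2: "norm (exp w) \<le> exp (norm w)" by (rule norm_exp)
  have "norm (exp w - (1 + w)) \<le> exp \<bar>Re w\<bar> * (norm w)\<^sup>2"
    using Taylor_exp[of w 1] by (simp add: power2_eq_square)
  also have "\<dots> \<le> exp (norm w) * (norm w)\<^sup>2"
    by (intro mult_right_mono) (use abs_Re_le_cmod in auto)
  finally have d: "norm ((1 + w) - exp w) \<le> exp (norm w) * (norm w)\<^sup>2" by (simp add: norm_minus_commute)
  have "norm ((1 + w) ^ k - exp (of_nat k * w)) = norm ((1 + w) ^ k - exp w ^ k)"
    by (simp add: exp_of_nat_mult)
  also have "\<dots> \<le> k * exp (norm w) ^ (k - 1) * norm ((1 + w) - exp w)"
    by (rule norm_power_diff_le[OF R1 R2]) simp
  also have "\<dots> \<le> k * exp (norm w) ^ (k - 1) * (exp (norm w) * (norm w)\<^sup>2)"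
    by (intro mult_left_mono d) simp
  also have "\<dots> = k * (exp (norm w) ^ (k - 1) * exp (norm w)) * (norm w)\<^sup>2" by simp
  also have "exp (norm w) ^ (k - 1) * exp (norm w) = exp (k * norm w)"
    using assms by (metis exp_of_nat_mult power_minus_mult)
  also have "k * exp (k * norm w) * (norm w)\<^sup>2 = exp (k * norm w) * (k * norm w)\<^sup>2 / k"
    using assms by (simp add: power2_eq_square)
  finally show ?thesis .
qed

lemma uniform_limit_compound_exp:
  fixes a :: "'i \<Rightarrow> complex \<Rightarrow> complex"
  assumes lim: "uniform_limit S (\<lambda>L z. of_nat (M L) * a L z) c F"
    and bdd: "bounded (c ` S)" and M: "filterlim M at_top F"
  shows "uniform_limit S (\<lambda>L z. (1 + a L z) ^ M L) (\<lambda>z. exp (c z)) F"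
proof -
  obtain C where C: "\<And>z. z \<in> S \<Longrightarrow> norm (c z) \<le> C" using bdd by (auto simp: bounded_iff)
  have ev: "\<forall>\<^sub>F L in F. \<forall>z\<in>S. norm (of_nat (M L) * a L z) \<le> C + 1"
    using uniform_limitD[OF lim zero_less_one]
  proof eventually_elim
    case (elim L)
    show ?case
    proof
      fix z assume z: "z \<in> S"
      have "norm (of_nat (M L) * a L z) \<le> norm (of_nat (M L) * a L z - c z) + norm (c z)"
        by (metis diff_add_cancel norm_triangle_ineq)
      then show "norm (of_nat (M L) * a L z) \<le> C + 1"
        using elim z C[OF z] by (force simp: dist_norm)
    qed
  qed
  have lim0: "((\<lambda>L. exp (C + 1) * (C + 1)\<^sup>2 / real (M L)) \<longlongrightarrow> 0) F"
    by (intro real_tendsto_divide_at_top[OF tendsto_const] filterlim_compose[OF filterlim_real_sequentially M])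
  have A: "uniform_limit S (\<lambda>L z. (1 + a L z) ^ M L - exp (of_nat (M L) * a L z)) (\<lambda>_. 0) F"
  proof (rule uniform_limitI)
    fix e :: real assume "e > 0"
    have M0: "\<forall>\<^sub>F L in F. M L > 0" by (rule eventually_compose_filterlim[OF eventually_gt_at_top M])
    have "\<forall>\<^sub>F L in F. exp (C + 1) * (C + 1)\<^sup>2 / real (M L) < e"
      using order_tendstoD(2)[OF lim0 \<open>e > 0\<close>] .
    with ev M0 show "\<forall>\<^sub>F L in F. \<forall>z\<in>S. dist ((1 + a L z) ^ M L - exp (of_nat (M L) * a L z)) 0 < e"
    proof eventually_elim
      case (elim L)
      show ?case
      proof
        fix z assume z: "z \<in> S"
        have le: "M L * norm (a L z) \<le> C + 1" using elim(1) z by (auto simp: norm_mult)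
        have "norm ((1 + a L z) ^ M L - exp (of_nat (M L) * a L z))
            \<le> exp (M L * norm (a L z)) * (M L * norm (a L z))\<^sup>2 / M L"
          by (rule norm_one_plus_power_minus_exp_le) (use elim in simp)
        also have "\<dots> \<le> exp (C + 1) * (C + 1)\<^sup>2 / M L"
          using le by (intro divide_right_mono mult_mono power_mono) auto
        also have "\<dots> < e" by fact
        finally show "dist ((1 + a L z) ^ M L - exp (of_nat (M L) * a L z)) 0 < e" by simp
      qed
    qed
  qed
  have B: "uniform_limit S (\<lambda>L z. exp (of_nat (M L) * a L z)) (\<lambda>z. exp (c z)) F"
  proof (rule uniform_limit_compose_uniformly_continuous_on[OF lim])
    show "uniformly_continuous_on (cball (0::complex) (C + 1)) exp"
      by (intro compact_uniformly_continuous continuous_intros) auto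
    show "\<forall>\<^sub>F L in F. \<forall>z\<in>S. of_nat (M L) * a L z \<in> cball 0 (C + 1)"
      using ev by simp
  qed simp
  show ?thesis using uniform_limit_add[OF A B] by simp
qed

lemma uniform_limit_of_tendsto:
  assumes "(f \<longlongrightarrow> l) F"
  shows "uniform_limit S (\<lambda>L _. f L) (\<lambda>_. l) F"
  by (rule uniform_limitI) (use tendstoD[OF assms] in \<open>auto elim: eventually_mono\<close>)

text \<open>
  The dependence on the parameters enters through the scalars \<open>m \<kappa>\<close> and \<open>n \<mu>\<close>, which converge to the
  coefficients in the exponent of the limiting integrand, and through \<open>\<sigma>\<close>, which converges to \<open>s\<close> while
  \<open>1 + s z\<close> stays away from zero on the circle.
\<close>

lemma uniform_limit_plane_wave:
  fixes s r x y \<mu>0 :: real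
  assumes r: "0 < r" "r < 1" "\<bar>1 - 1 / s\<bar> > r" "s > 0"
    and \<sigma>: "(\<sigma> \<longlongrightarrow> s) F"
    and m: "filterlim m at_top F" and n: "filterlim n at_top F"
    and \<kappa>: "((\<lambda>L. real (m L) * \<kappa> L) \<longlongrightarrow> - x * ln qq * s) F"
    and \<mu>: "((\<lambda>L. real (n L) * \<mu> L) \<longlongrightarrow> y * ln qq) F"
  shows "uniform_limit (sphere (- 1) r) (\<lambda>L. plane_wave (\<sigma> L) (\<kappa> L) (\<mu> L) (m L) (n L)) (limit_integrand qq s x y) F"
proof -
  let ?S = "sphere (- 1) r :: complex set"
  have nz: "z \<noteq> 0" "1 + z \<noteq> 0" "1 + complex_of_real s * z \<noteq> 0" if "z \<in> ?S" for z
    using that r denominator_nonzero[OF r(3), of z] zero_notin_cball[of r]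
    by (auto simp: add_eq_0_iff)
  have cb: "bounded (f ` ?S)" if "continuous_on ?S f" for f :: "complex \<Rightarrow> complex"
    by (intro compact_imp_bounded compact_continuous_image that compact_sphere)
  have cont1: "continuous_on ?S (\<lambda>z. 1 + complex_of_real s * z)" by (intro continuous_intros)
  have "compact ((\<lambda>z. norm (1 + complex_of_real s * z)) ` ?S)"
    by (intro compact_continuous_image continuous_intros compact_sphere)
  moreover have "?S \<noteq> {}" using r by simp
  ultimately obtain z0 where z0: "z0 \<in> ?S" "\<And>z. z \<in> ?S \<Longrightarrow> norm (1 + complex_of_real s * z0) \<le> norm (1 + complex_of_real s * z)"
    using compact_attains_inf[of "(\<lambda>z. norm (1 + complex_of_real s * z)) ` ?S"] by (auto simp: ball_simps)
  have \<sigma>': "((\<lambda>L. complex_of_real (\<sigma> L)) \<longlongrightarrow> of_real s) F" by (intro tendsto_of_real \<sigma>)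
  have den: "uniform_limit ?S (\<lambda>L z. 1 + complex_of_real (\<sigma> L) * z) (\<lambda>z. 1 + complex_of_real s * z) F"
    by (intro uniform_limit_add uniform_limit_const uniform_lim_mult uniform_limit_of_tendsto \<sigma>' cb continuous_intros)
  have frac: "uniform_limit ?S (\<lambda>L z. z / (1 + complex_of_real (\<sigma> L) * z)) (\<lambda>z. z / (1 + complex_of_real s * z)) F"
    by (rule uniform_lim_divide[OF uniform_limit_const den _ z0(2)])
       (use nz z0 in \<open>auto intro!: cb continuous_intros\<close>)
  have m1: "uniform_limit ?S (\<lambda>L z. complex_of_real (real (m L) * \<kappa> L) * (z / (1 + complex_of_real (\<sigma> L) * z)))
     (\<lambda>z. of_real (- x * ln qq * s) * (z / (1 + complex_of_real s * z))) F"
    by (intro uniform_lim_mult uniform_limit_of_tendsto tendsto_of_real \<kappa> frac cb continuous_intros) (use nz in auto)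
  have n1: "uniform_limit ?S (\<lambda>L z. complex_of_real (real (n L) * \<mu> L) * (z / (1 + z)))
     (\<lambda>z. of_real (y * ln qq) * (z / (1 + z))) F"
    by (intro uniform_lim_mult uniform_limit_of_tendsto tendsto_of_real \<mu> uniform_limit_const cb continuous_intros) (use nz in auto)
  have m2: "uniform_limit ?S (\<lambda>L z. (1 + of_real (\<kappa> L) * (z / (1 + of_real (\<sigma> L) * z))) ^ m L)
     (\<lambda>z. exp (of_real (- x * ln qq * s) * (z / (1 + complex_of_real s * z)))) F"
    by (rule uniform_limit_compound_exp[OF _ _ m])
       (use m1 nz in \<open>auto simp: mult.assoc intro!: cb continuous_intros\<close>)
  have n2: "uniform_limit ?S (\<lambda>L z. (1 + of_real (\<mu> L) * (z / (1 + z))) ^ n L)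
     (\<lambda>z. exp (of_real (y * ln qq) * (z / (1 + z)))) F"
    by (rule uniform_limit_compound_exp[OF _ _ n])
       (use n1 nz in \<open>auto simp: mult.assoc intro!: cb continuous_intros\<close>)
  have "uniform_limit ?S (\<lambda>L z. (1 + of_real (\<kappa> L) * (z / (1 + of_real (\<sigma> L) * z))) ^ m L *
        (1 + of_real (\<mu> L) * (z / (1 + z))) ^ n L * (1 / z))
     (\<lambda>z. exp (of_real (- x * ln qq * s) * (z / (1 + complex_of_real s * z))) *
          exp (of_real (y * ln qq) * (z / (1 + z))) * (1 / z)) F"
    by (intro uniform_lim_mult m2 n2 uniform_limit_const cb continuous_intros) (use nz in auto)
  moreover have "exp (of_real (- x * ln qq * s) * (z / (1 + complex_of_real s * z))) *
          exp (of_real (y * ln qq) * (z / (1 + z))) * (1 / z) = limit_integrand qq s x y z" for z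
    unfolding limit_integrand_def exp_add[symmetric] by (simp add: algebra_simps)
  ultimately show ?thesis by (simp add: plane_wave_def[abs_def])
qed

section \<open>The limit equation\<close>

lemma limit_lhs_height_transform:
  assumes "\<alpha> \<ge> 0" "qq > 0"
  shows "limit_lhs qq \<alpha> x y h = height_transform qq \<alpha> (y - x) h / (1 + \<alpha>)"
proof (cases "\<alpha> = 0")
  case False
  have "qq powr (y - x - h) = qq powr (- h) * qq powr (y - x)"
    by (simp flip: powr_add)
  then have "height_transform qq \<alpha> (y - x) h = (1 + \<alpha> * (qq powr (- h) * qq powr (y - x))) * (qq powr h - 1)"
    by (simp add: height_transform_def)
  moreover have "e + inverse \<alpha> = (1 + \<alpha> * e) / \<alpha>" for e
    using False by (simp add: field_simps)
  then have "limit_lhs qq \<alpha> x y h =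
      ((1 + \<alpha> * (qq powr (- h) * qq powr (y - x))) / \<alpha>) * (qq powr h - 1) / ((1 + \<alpha>) / \<alpha>)"
    using False by (simp add: limit_lhs_def del: times_divide_eq_left)
  ultimately show ?thesis using False by simp
qed (simp add: limit_lhs_def height_transform_def)

lemma abs_exp_diff_ge: "exp (min a c) * \<bar>a - c\<bar> \<le> \<bar>exp a - exp (c :: real)\<bar>"
proof -
  have *: "exp c * (a - c) \<le> exp a - exp c" for a c :: real
  proof -
    have "exp c * (1 + (a - c)) \<le> exp c * exp (a - c)"
      by (intro mult_left_mono exp_ge_add_one_self) simp
    then show ?thesis by (simp add: algebra_simps flip: exp_add)
  qed
  show ?thesis using *[of a c] *[of c a] by (cases "a \<le> c") (auto simp: min_def)
qed

text \<open>
  Both exponential terms of the transform are monotone in the same direction, whatever the sign of \<open>k\<close>,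
  so the second can only increase the distance. The constant does not depend on \<open>c\<close>.
\<close>

lemma height_transform_expansive:
  assumes qq: "qq = exp k" and "\<alpha> \<ge> 0" "\<bar>h\<bar> \<le> Y" "\<bar>h'\<bar> \<le> Y"
  shows "\<bar>k\<bar> * exp (- \<bar>k\<bar> * Y) * \<bar>h - h'\<bar> \<le> \<bar>height_transform qq \<alpha> c h - height_transform qq \<alpha> c h'\<bar>"
proof -
  have p: "qq powr t = exp (k * t)" for t by (simp add: qq powr_def mult.commute)
  define P where "P = exp (k * h) - exp (k * h')"
  define Q where "Q = \<alpha> * (exp (k * (c - h')) - exp (k * (c - h)))"
  have eq: "height_transform qq \<alpha> c h - height_transform qq \<alpha> c h' = P + Q"
    unfolding height_transform_expand p P_def Q_def by (simp add: algebra_simps)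
  have "0 \<le> P \<and> 0 \<le> Q \<or> P \<le> 0 \<and> Q \<le> 0"
  proof (cases "k * h' \<le> k * h")
    case True
    then have "k * (c - h) \<le> k * (c - h')" by (simp add: right_diff_distrib)
    then show ?thesis using True assms by (simp add: P_def Q_def)
  next
    case False
    then have "k * (c - h') \<le> k * (c - h)" by (simp add: right_diff_distrib)
    then show ?thesis using False assms by (simp add: P_def Q_def mult_nonneg_nonpos)
  qed
  then have "\<bar>P\<bar> \<le> \<bar>P + Q\<bar>" by linarith
  moreover have "\<bar>k * h\<bar> \<le> \<bar>k\<bar> * Y" "\<bar>k * h'\<bar> \<le> \<bar>k\<bar> * Y"
    using assms by (auto simp: abs_mult intro!: mult_left_mono)
  then have "- \<bar>k\<bar> * Y \<le> min (k * h) (k * h')" by auto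
  then have "exp (- \<bar>k\<bar> * Y) * \<bar>k * h - k * h'\<bar> \<le> exp (min (k * h) (k * h')) * \<bar>k * h - k * h'\<bar>"
    by (intro mult_right_mono) auto
  moreover have "\<bar>k * h - k * h'\<bar> = \<bar>k\<bar> * \<bar>h - h'\<bar>" by (simp flip: right_diff_distrib add: abs_mult)
  ultimately show ?thesis
    using abs_exp_diff_ge[of "k * h" "k * h'"] unfolding eq P_def by (simp add: mult_ac)
qed

lemma height_transform_inj:
  assumes "qq = exp k" "k \<noteq> 0" "\<alpha> \<ge> 0" "height_transform qq \<alpha> c h = height_transform qq \<alpha> c h'"
  shows "h = h'"
proof -
  have "\<bar>k\<bar> * exp (- \<bar>k\<bar> * max \<bar>h\<bar> \<bar>h'\<bar>) * \<bar>h - h'\<bar> \<le> 0"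
    using height_transform_expansive[OF assms(1,3), of h "max \<bar>h\<bar> \<bar>h'\<bar>" h' c] assms(4) by simp
  then have "\<bar>k\<bar> * (exp (- \<bar>k\<bar> * max \<bar>h\<bar> \<bar>h'\<bar>) * \<bar>h - h'\<bar>) = 0"
    by (intro antisym) (simp_all add: mult.assoc)
  then show ?thesis using assms(2) by simp
qed

text \<open>
  The factor \<open>sgn k\<close> treats the two cases \<open>\<beta>\<^sub>1 > \<beta>\<^sub>2\<close> and \<open>\<beta>\<^sub>1 < \<beta>\<^sub>2\<close> at once: the transform increases in
  the first and decreases in the second.
\<close>

lemma height_transform_sgn_mono:
  assumes qq: "qq = exp k" and "\<alpha> \<ge> 0" "h \<le> h'"
  shows "sgn k * height_transform qq \<alpha> c h \<le> sgn k * height_transform qq \<alpha> c h'"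
proof -
  have p: "qq powr t = exp (k * t)" for t by (simp add: qq powr_def mult.commute)
  consider "k > 0" | "k = 0" | "k < 0" by linarith
  then show ?thesis
  proof cases
    case 1
    then have "\<alpha> * exp (k * (c - h')) \<le> \<alpha> * exp (k * (c - h))"
      using assms by (intro mult_left_mono) auto
    moreover have "exp (k * h) \<le> exp (k * h')" using 1 assms by simp
    ultimately have "height_transform qq \<alpha> c h \<le> height_transform qq \<alpha> c h'" unfolding height_transform_expand p by linarith
    then show ?thesis using 1 by simp
  next
    case 3
    then have "\<alpha> * exp (k * (c - h)) \<le> \<alpha> * exp (k * (c - h'))"
      using assms by (intro mult_left_mono) (auto simp: mult_left_mono_neg)
    moreover have "exp (k * h') \<le> exp (k * h)" using 3 assms by (simp add: mult_left_mono_neg)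
    ultimately have "height_transform qq \<alpha> c h' \<le> height_transform qq \<alpha> c h" unfolding height_transform_expand p by linarith
    then show ?thesis using 3 by simp
  qed simp
qed

lemma height_transform_0 [simp]: "qq > 0 \<Longrightarrow> height_transform qq \<alpha> c 0 = 0"
  by (simp add: height_transform_def)

text \<open>
  By the residue theorem the integral over any admissible contour is \<open>2 \<pi> i\<close> times the residue at \<open>-1\<close>.
  It therefore suffices to work with a circle.
\<close>

lemma limit_rhs_contour_independent:
  assumes "admissible_contour s \<gamma>" "admissible_contour s \<gamma>'"
  shows "limit_rhs \<gamma> qq s x y = limit_rhs \<gamma>' qq s x y"
proof -
  let ?P = "{- 1, 0, - 1 / of_real s} :: complex set"
  have hol: "limit_integrand qq s x y holomorphic_on UNIV - ?P"
  proof -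
    have "1 + complex_of_real s * z \<noteq> 0" if "z \<notin> ?P" for z
    proof
      assume "1 + complex_of_real s * z = 0"
      moreover from this have "s \<noteq> 0" by auto
      ultimately have "z = - 1 / of_real s" by (simp add: field_simps eq_neg_iff_add_eq_0 add.commute)
      then show False using that by simp
    qed
    moreover have "1 + z \<noteq> 0" if "z \<notin> ?P" for z :: complex using that by (auto simp: add_eq_0_iff)
    ultimately show ?thesis
      unfolding limit_integrand_def[abs_def] by (auto intro!: holomorphic_intros)
  qed
  have "contour_integral \<gamma> (limit_integrand qq s x y) = 2 * pi * \<i> * residue (limit_integrand qq s x y) (- 1)"
    if "admissible_contour s \<gamma>" for \<gamma>
  proof -
    have w: "winding_number \<gamma> p = (if p = - 1 then 1 else 0)" if "p \<in> ?P" for p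
      using that \<open>admissible_contour s \<gamma>\<close> unfolding admissible_contour_def by auto
    have "contour_integral \<gamma> (limit_integrand qq s x y) =
        2 * pi * \<i> * (\<Sum>p\<in>?P. winding_number \<gamma> p * residue (limit_integrand qq s x y) p)"
      by (rule Residue_theorem[OF open_UNIV connected_UNIV _ hol])
         (use that in \<open>auto simp: admissible_contour_def\<close>)
    also have "(\<Sum>p\<in>?P. winding_number \<gamma> p * residue (limit_integrand qq s x y) p) =
       (\<Sum>p\<in>?P. if p = - 1 then residue (limit_integrand qq s x y) p else 0)"
      by (intro sum.cong refl) (simp add: w)
    also have "\<dots> = residue (limit_integrand qq s x y) (- 1)"
      by (simp add: sum.delta)
    finally show ?thesis .
  qed
  then show ?thesis using assms by (simp add: limit_rhs_def)
qed

lemma admissible_circle: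
  assumes "0 < r" "r < 1" "r < \<bar>1 - 1 / s\<bar>" "s \<noteq> 0"
  shows "admissible_contour s (circlepath (- 1) r)"
proof -
  have out: "winding_number (circlepath (- 1) r) w = 0" if "w \<notin> cball (- 1) r" for w
    by (rule winding_number_zero_outside[of _ "cball (- 1) r"]) (use that assms in auto)
  have n0: "(0::complex) \<notin> cball (- 1) r" by (rule zero_notin_cball) fact
  have ns: "- 1 / complex_of_real s \<notin> cball (- 1) r"
    using denominator_nonzero[OF assms(3,4), of "- 1 / complex_of_real s"] assms(4) by auto
  have "- 1 \<notin> sphere (- 1 :: complex) r" using assms by simp
  then have "path_image (circlepath (- 1) r) \<inter> {- 1, 0, - 1 / of_real s} = {}"
    using n0 ns assms by auto
  then show ?thesis unfolding admissible_contour_def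
    using assms out[OF n0] out[OF ns] by (simp add: winding_number_circlepath_centre)
qed

section \<open>Weakly asymmetric scaling at lattice points\<close>

text \<open>
  The parameters as functions of the scale \<open>L\<close>. Convergence of lattice points is expressed by
  arbitrary sequences \<open>m\<close> and \<open>n\<close> with \<open>m/L \<rightarrow> x\<close> and \<open>n/L \<rightarrow> y\<close>, because the interpolated height at
  \<open>(Lx, Ly)\<close> involves four of them.
\<close>

locale weak_asymmetry =
  fixes \<beta>\<^sub>1 \<beta>\<^sub>2 \<alpha> :: real
  assumes \<beta>\<^sub>1: "\<beta>\<^sub>1 > 0" and \<beta>\<^sub>2: "\<beta>\<^sub>2 > 0" and \<beta>_neq: "\<beta>\<^sub>1 \<noteq> \<beta>\<^sub>2" and \<alpha>: "\<alpha> \<ge> 0"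
begin

definition b :: "real \<Rightarrow> real" where "b L = exp (- \<beta>\<^sub>1 / L)"
definition q :: "real \<Rightarrow> real" where "q L = exp ((\<beta>\<^sub>1 - \<beta>\<^sub>2) / L)"
definition qq :: real where "qq = exp (\<beta>\<^sub>1 - \<beta>\<^sub>2)"
definition s :: real where "s = \<beta>\<^sub>1 / \<beta>\<^sub>2"
definition \<sigma> :: "real \<Rightarrow> real" where "\<sigma> L = q L * (1 - b L) / (1 - b L * q L)"

lemma bq: "b L * q L = exp (- \<beta>\<^sub>2 / L)"
  unfolding b_def q_def exp_add[symmetric] by (simp add: diff_divide_distrib)

lemma model: "L > 0 \<Longrightarrow> dynamic_six_vertex (b L) (q L) \<alpha>"
  by unfold_locales (use \<beta>\<^sub>1 \<beta>\<^sub>2 \<alpha> in \<open>simp_all add: bq\<close>, simp_all add: b_def q_def)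

lemma q_powr: "q L powr t = qq powr (t / L)"
  by (simp add: q_def qq_def powr_def)

lemma s_pos: "s > 0" and s_neq: "s \<noteq> 1"
  using \<beta>\<^sub>1 \<beta>\<^sub>2 \<beta>_neq by (auto simp: s_def)

lemma lim_b: "((\<lambda>L. L * (1 - b L)) \<longlongrightarrow> \<beta>\<^sub>1) at_top"
  unfolding b_def using \<beta>\<^sub>1 by real_asymp

lemma lim_bq: "((\<lambda>L. L * (1 - b L * q L)) \<longlongrightarrow> \<beta>\<^sub>2) at_top"
  unfolding bq using \<beta>\<^sub>2 by real_asymp

lemma lim_q: "(q \<longlongrightarrow> 1) at_top"
  unfolding q_def[abs_def] by real_asymp

lemma lim_q1: "((\<lambda>L. L * (q L - 1)) \<longlongrightarrow> \<beta>\<^sub>1 - \<beta>\<^sub>2) at_top"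
  unfolding q_def using \<beta>_neq by real_asymp

lemma lim_\<sigma>: "(\<sigma> \<longlongrightarrow> s) at_top"
proof -
  have "((\<lambda>L. q L * ((L * (1 - b L)) / (L * (1 - b L * q L)))) \<longlongrightarrow> 1 * (\<beta>\<^sub>1 / \<beta>\<^sub>2)) at_top"
    using \<beta>\<^sub>2 by (intro tendsto_intros lim_b lim_bq lim_q) auto
  moreover have "\<forall>\<^sub>F L in at_top. q L * ((L * (1 - b L)) / (L * (1 - b L * q L))) = \<sigma> L"
    using eventually_gt_at_top[of 0] by eventually_elim (simp add: \<sigma>_def)
  ultimately show ?thesis unfolding s_def by (simp add: filterlim_cong)
qed

text \<open>
  A radius for which the circle around \<open>-1\<close> keeps a positive distance to \<open>0\<close> and \<open>-1/s\<close>, so that it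
  also avoids \<open>-1/\<sigma> L\<close> for large \<open>L\<close>.
\<close>

definition \<rho> :: real where "\<rho> = min 1 \<bar>1 - 1 / s\<bar> / 2"

lemma \<rho>: "0 < \<rho>" "\<rho> < 1" "\<rho> < \<bar>1 - 1 / s\<bar>"
  using s_pos s_neq by (auto simp: \<rho>_def min_def field_simps)

definition J :: "real \<Rightarrow> real \<Rightarrow> complex" where
  "J x y = limit_rhs (circlepath (- 1) \<rho>) qq s x y"

lemma limit_rhs_eq_J: "admissible_contour s \<gamma> \<Longrightarrow> limit_rhs \<gamma> qq s x y = J x y"
  unfolding J_def using \<rho> s_pos by (intro limit_rhs_contour_independent admissible_circle) auto

lemma scaled_at_top:
  assumes "((\<lambda>L. real (m L) / L) \<longlongrightarrow> x) at_top" "x > 0"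
  shows "filterlim m at_top at_top"
proof -
  have "filterlim (\<lambda>L. (real (m L) / L) * L) at_top at_top"
    by (rule filterlim_tendsto_pos_mult_at_top[OF assms filterlim_ident])
  moreover have "\<forall>\<^sub>F L in at_top. (real (m L) / L) * L = real (m L)"
    using eventually_gt_at_top[of 0] by eventually_elim simp
  ultimately have "filterlim (\<lambda>L. real (m L)) at_top at_top" by (simp add: filterlim_cong)
  then show ?thesis
    by (metis filterlim_at_top filterlim_sequentially_iff_filterlim_real)
qed

context
  fixes x y :: real and m n :: "real \<Rightarrow> nat"
  assumes x: "x > 0" and y: "y > 0"
    and m: "((\<lambda>L. real (m L) / L) \<longlongrightarrow> x) at_top"
    and n: "((\<lambda>L. real (n L) / L) \<longlongrightarrow> y) at_top"
begin

lemma mean_tendsto_complex: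
  "((\<lambda>L. complex_of_real (dynamic_six_vertex.mean (b L) (q L) \<alpha> (m L) (n L))) \<longlongrightarrow> (1 + of_real \<alpha>) * J x y) at_top"
proof -
  have \<kappa>: "((\<lambda>L. real (m L) * ((1 - b L) * (1 - \<sigma> L))) \<longlongrightarrow> - x * ln qq * s) at_top"
  proof -
    have "((\<lambda>L. (real (m L) / L) * ((L * (1 - b L)) * (1 - \<sigma> L))) \<longlongrightarrow> x * (\<beta>\<^sub>1 * (1 - s))) at_top"
      by (intro tendsto_intros m lim_b lim_\<sigma>)
    moreover have "\<forall>\<^sub>F L in at_top. (real (m L) / L) * ((L * (1 - b L)) * (1 - \<sigma> L)) = real (m L) * ((1 - b L) * (1 - \<sigma> L))"
      using eventually_gt_at_top[of 0] by eventually_elim simp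
    moreover have "x * (\<beta>\<^sub>1 * (1 - s)) = - x * ln qq * s"
      using \<beta>\<^sub>2 by (simp add: s_def qq_def field_simps)
    ultimately show ?thesis by (simp add: filterlim_cong)
  qed
  have \<mu>: "((\<lambda>L. real (n L) * (q L - 1)) \<longlongrightarrow> y * ln qq) at_top"
  proof -
    have "((\<lambda>L. (real (n L) / L) * (L * (q L - 1))) \<longlongrightarrow> y * (\<beta>\<^sub>1 - \<beta>\<^sub>2)) at_top"
      by (intro tendsto_intros n lim_q1)
    moreover have "\<forall>\<^sub>F L in at_top. (real (n L) / L) * (L * (q L - 1)) = real (n L) * (q L - 1)"
      using eventually_gt_at_top[of 0] by eventually_elim simp
    ultimately show ?thesis by (simp add: filterlim_cong qq_def)
  qed
  have "((\<lambda>L. \<bar>1 - 1 / \<sigma> L\<bar>) \<longlongrightarrow> \<bar>1 - 1 / s\<bar>) at_top"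
    using s_pos by (intro tendsto_intros lim_\<sigma>) auto
  then have ev: "\<forall>\<^sub>F L in at_top. \<rho> < \<bar>1 - 1 / \<sigma> L\<bar>"
    by (rule order_tendstoD(1)) (rule \<rho>)
  have evs: "\<forall>\<^sub>F L in at_top. \<sigma> L > 0"
    by (rule order_tendstoD(1)[OF lim_\<sigma> s_pos])
  let ?pw = "\<lambda>L. plane_wave (\<sigma> L) ((1 - b L) * (1 - \<sigma> L)) (q L - 1) (m L) (n L)"
  have "((\<lambda>L. contour_integral (circlepath (- 1) \<rho>) (?pw L)) \<longlongrightarrow>
      contour_integral (circlepath (- 1) \<rho>) (limit_integrand qq s x y)) at_top"
  proof (rule contour_integral_uniform_limit_circlepath(2))
    show "\<forall>\<^sub>F L in at_top. ?pw L contour_integrable_on circlepath (- 1) \<rho>"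
      using ev evs
    proof eventually_elim
      case (elim L)
      then show ?case using \<rho> by (intro plane_wave_contour_integrable) auto
    qed
    show "uniform_limit (sphere (- 1) \<rho>) ?pw (limit_integrand qq s x y) at_top"
      by (rule uniform_limit_plane_wave[OF \<rho> s_pos lim_\<sigma> scaled_at_top[OF m x] scaled_at_top[OF n y] \<kappa> \<mu>])
  qed (use \<rho> in auto)
  then have "((\<lambda>L. (1 + of_real \<alpha>) / (2 * of_real pi * \<i>) * contour_integral (circlepath (- 1) \<rho>) (?pw L)) \<longlongrightarrow>
      (1 + of_real \<alpha>) / (2 * of_real pi * \<i>) * contour_integral (circlepath (- 1) \<rho>) (limit_integrand qq s x y)) at_top"
    by (intro tendsto_intros)
  moreover have "\<forall>\<^sub>F L in at_top. (1 + of_real \<alpha>) / (2 * of_real pi * \<i>) * contour_integral (circlepath (- 1) \<rho>) (?pw L) =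
      complex_of_real (dynamic_six_vertex.mean (b L) (q L) \<alpha> (m L) (n L))"
    using ev eventually_gt_at_top[of 0]
  proof eventually_elim
    case (elim L)
    interpret D: dynamic_six_vertex "b L" "q L" \<alpha> using elim model by blast
    have "D.\<sigma> = \<sigma> L" by (simp add: D.\<sigma>_def \<sigma>_def)
    then show ?case using D.mean_contour_integral[of \<rho> "m L" "n L"] elim \<rho> by simp
  qed
  ultimately show ?thesis
    by (simp add: J_def limit_rhs_def filterlim_cong)
qed

text \<open>
  The contour integral is a limit of expectations of real random variables.
\<close>

lemma J_real: "J x y = of_real (Re (J x y))"
proof -
  have "((\<lambda>L. 0) \<longlongrightarrow> Im ((1 + of_real \<alpha>) * J x y)) (at_top :: real filter)"
    using tendsto_Im[OF mean_tendsto_complex] by simp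
  then have "Im ((1 + of_real \<alpha>) * J x y) = 0"
    using tendsto_unique[OF trivial_limit_at_top_linorder _ tendsto_const] by blast
  then have "Im (J x y) = 0" using \<alpha> by simp
  then show ?thesis by (simp add: complex_eq_iff)
qed

lemma mean_tendsto:
  "((\<lambda>L. dynamic_six_vertex.mean (b L) (q L) \<alpha> (m L) (n L)) \<longlongrightarrow> (1 + \<alpha>) * Re (J x y)) at_top"
  using tendsto_Re[OF mean_tendsto_complex] by simp

lemma obs_eq_height_transform:
  assumes "L > 0"
  shows "dynamic_six_vertex.obs (b L) (q L) \<alpha> \<eta> i j =
     height_transform qq \<alpha> ((real j - real i) / L) (real (height (b L) (q L) \<alpha> \<eta> (Suc i) j) / L)"
proof -
  interpret D: dynamic_six_vertex "b L" "q L" \<alpha> using assms model by blast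
  show ?thesis unfolding D.obs_def height_transform_def q_powr by (simp add: diff_divide_distrib)
qed

lemma lim_c: "((\<lambda>L. (real (n L) - real (m L)) / L) \<longlongrightarrow> y - x) at_top"
  unfolding diff_divide_distrib by (intro tendsto_intros m n)

text \<open>
  For \<open>\<alpha> = 0\<close> the transform is not surjective, so solvability is a statement about the contour integral.
  It is inherited from the lattice: the height lies between \<open>0\<close> and \<open>n\<close>, so by monotonicity the mean of
  the observable lies between the values of the transform at \<open>0\<close> and \<open>n/L\<close>. These bounds pass to the
  limit, and the intermediate value theorem applies on \<open>[0,y]\<close>.
\<close>

lemma limit_height_exists: "\<exists>h. 0 \<le> h \<and> h \<le> y \<and> height_transform qq \<alpha> (y - x) h = (1 + \<alpha>) * Re (J x y)"
proof -
  define k where "k = \<beta>\<^sub>1 - \<beta>\<^sub>2"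
  have k: "qq = exp k" "k \<noteq> 0" using \<beta>_neq by (auto simp: k_def qq_def)
  have qq: "qq > 0" by (simp add: k)
  let ?\<mu> = "\<lambda>L. dynamic_six_vertex.mean (b L) (q L) \<alpha> (m L) (n L)"
  have bounds: "\<forall>\<^sub>F L in at_top. 0 \<le> sgn k * ?\<mu> L \<and>
     sgn k * ?\<mu> L \<le> sgn k * height_transform qq \<alpha> ((real (n L) - real (m L)) / L) (real (n L) / L)"
    using eventually_gt_at_top[of 0]
  proof eventually_elim
    case (elim L)
    interpret D: dynamic_six_vertex "b L" "q L" \<alpha> using elim model by blast
    let ?c = "(real (n L) - real (m L)) / L"
    have int: "integrable vertex_noise (\<lambda>\<eta>. sgn k * D.obs \<eta> (m L) (n L))"
      using D.obs_integrable by simp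
    have eq: "sgn k * ?\<mu> L = (\<integral>\<eta>. sgn k * D.obs \<eta> (m L) (n L) \<partial>vertex_noise)"
      unfolding D.mean_def by simp
    have o: "0 \<le> sgn k * D.obs \<eta> (m L) (n L)" "sgn k * D.obs \<eta> (m L) (n L) \<le> sgn k * height_transform qq \<alpha> ?c (real (n L) / L)" for \<eta>
    proof -
      have "real (height (b L) (q L) \<alpha> \<eta> (Suc (m L)) (n L)) / L \<le> real (n L) / L"
        using elim height_le by (simp add: divide_right_mono)
      then show "sgn k * D.obs \<eta> (m L) (n L) \<le> sgn k * height_transform qq \<alpha> ?c (real (n L) / L)"
        unfolding obs_eq_height_transform[OF elim] by (intro height_transform_sgn_mono k \<alpha>)
      have "sgn k * height_transform qq \<alpha> ?c 0 \<le> sgn k * D.obs \<eta> (m L) (n L)"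
        unfolding obs_eq_height_transform[OF elim] using elim by (intro height_transform_sgn_mono k \<alpha>) auto
      then show "0 \<le> sgn k * D.obs \<eta> (m L) (n L)" using qq by simp
    qed
    show ?case unfolding eq
      by (intro conjI vertex_noise.integral_ge_const vertex_noise.integral_le_const int AE_I2 o)
  qed
  have lim: "((\<lambda>L. sgn k * ?\<mu> L) \<longlongrightarrow> sgn k * ((1 + \<alpha>) * Re (J x y))) at_top"
    by (intro tendsto_intros mean_tendsto)
  have lim2: "((\<lambda>L. sgn k * height_transform qq \<alpha> ((real (n L) - real (m L)) / L) (real (n L) / L)) \<longlongrightarrow> sgn k * height_transform qq \<alpha> (y - x) y) at_top"
    unfolding height_transform_def using qq by (intro tendsto_intros lim_c n) auto
  have ge: "0 \<le> sgn k * ((1 + \<alpha>) * Re (J x y))"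
    by (rule tendsto_lowerbound[OF lim]) (use bounds in \<open>auto elim: eventually_mono\<close>)
  have le: "sgn k * ((1 + \<alpha>) * Re (J x y)) \<le> sgn k * height_transform qq \<alpha> (y - x) y"
    by (rule tendsto_le[OF _ lim2 lim]) (use bounds in \<open>auto elim: eventually_mono\<close>)
  have "\<exists>h\<ge>0. h \<le> y \<and> sgn k * height_transform qq \<alpha> (y - x) h = sgn k * ((1 + \<alpha>) * Re (J x y))"
  proof (rule IVT')
    show "continuous_on {0..y} (\<lambda>h. sgn k * height_transform qq \<alpha> (y - x) h)"
      unfolding height_transform_def using qq by (intro continuous_intros) auto
  qed (use ge le qq y in auto)
  then show ?thesis using k by (auto simp: sgn_0_0)
qed

lemma obs_concentration_limit:
  "((\<lambda>L. \<integral>\<eta>. \<bar>dynamic_six_vertex.obs (b L) (q L) \<alpha> \<eta> (m L) (n L) - dynamic_six_vertex.mean (b L) (q L) \<alpha> (m L) (n L)\<bar> \<partial>vertex_noise) \<longlongrightarrow> 0) at_top"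
    (is "(?E \<longlongrightarrow> 0) at_top")
proof -
  define k where "k = \<beta>\<^sub>1 - \<beta>\<^sub>2"
  \<comment> \<open>a convenient common bound for both coordinates, still of order \<open>L\<close>\<close>
  define N where "N L = m L + n L" for L
  have N: "((\<lambda>L. real (N L) / L) \<longlongrightarrow> x + y) at_top"
    unfolding N_def of_nat_add add_divide_distrib by (intro tendsto_intros m n)
  define K where "K L = (1 + \<alpha>) * exp (\<bar>k\<bar> * (2 * (real (N L) / L)))" for L
  define G where "G L = real (N L) / L * sqrt ((1 - b L) + (1 - b L * q L)) * (\<bar>L * (q L - 1)\<bar> * (1 + 1 / q L) * K L)
      * exp ((L * (1 - b L)) * (L * (1 - b L * q L)) * (real (N L) / L) * (real (n L) / L))" for L
  have "((\<lambda>L. 1 - b L) \<longlongrightarrow> 0) at_top" unfolding b_def by real_asymp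
  moreover have "((\<lambda>L. 1 - b L * q L) \<longlongrightarrow> 0) at_top" unfolding bq by real_asymp
  ultimately have "(G \<longlongrightarrow> (x + y) * sqrt (0 + 0) * (\<bar>\<beta>\<^sub>1 - \<beta>\<^sub>2\<bar> * (1 + 1 / 1) * ((1 + \<alpha>) * exp (\<bar>k\<bar> * (2 * (x + y)))))
      * exp (\<beta>\<^sub>1 * \<beta>\<^sub>2 * (x + y) * y)) at_top"
    unfolding G_def[abs_def] K_def by (intro tendsto_intros N n lim_b lim_bq lim_q lim_q1) auto
  then have G0: "(G \<longlongrightarrow> 0) at_top" by simp
  have "\<forall>\<^sub>F L in at_top. 0 \<le> ?E L \<and> ?E L \<le> G L"
    using eventually_gt_at_top[of 0]
  proof eventually_elim
    case (elim L)
    interpret D: dynamic_six_vertex "b L" "q L" \<alpha> using elim model by blast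
    have pw: "q L powr t \<le> exp (\<bar>k\<bar> * (2 * (real (N L) / L)))" if "\<bar>t\<bar> \<le> 2 * real (N L)" for t
    proof -
      have "k * t \<le> \<bar>k\<bar> * \<bar>t\<bar>" by (metis abs_ge_self abs_mult)
      also have "\<dots> \<le> \<bar>k\<bar> * (2 * real (N L))" using that by (intro mult_left_mono) auto
      finally have "k * t / L \<le> \<bar>k\<bar> * (2 * real (N L)) / L" using elim by (intro divide_right_mono) auto
      then show ?thesis by (simp add: q_def powr_def k_def mult.commute)
    qed
    have K: "q L powr real A + \<alpha> * q L powr (real j - real i - real A) \<le> K L"
      if "i < N L" "j < N L" "A \<le> j" for i j A
    proof -
      have "q L powr real A \<le> exp (\<bar>k\<bar> * (2 * (real (N L) / L)))" using that by (intro pw) auto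
      moreover have "q L powr (real j - real i - real A) \<le> exp (\<bar>k\<bar> * (2 * (real (N L) / L)))"
        using that by (intro pw) auto
      then have "\<alpha> * q L powr (real j - real i - real A) \<le> \<alpha> * exp (\<bar>k\<bar> * (2 * (real (N L) / L)))"
        using \<alpha> by (rule mult_left_mono)
      ultimately show ?thesis by (simp add: K_def algebra_simps)
    qed
    have K0: "K L \<ge> 0" using \<alpha> by (simp add: K_def)
    have "?E L \<le> real (N L) * sqrt ((1 - b L) + (1 - b L * q L)) * \<bar>\<bar>1 - q L\<bar> * (1 + 1 / q L) * K L\<bar>
        * (1 + (1 - b L) * (1 - b L * q L) * N L) ^ n L"
      by (rule D.obs_concentration[OF _ _ K]) (auto simp: N_def)
    also have "\<dots> \<le> real (N L) * sqrt ((1 - b L) + (1 - b L * q L)) * \<bar>\<bar>1 - q L\<bar> * (1 + 1 / q L) * K L\<bar>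
        * exp ((L * (1 - b L)) * (L * (1 - b L * q L)) * (real (N L) / L) * (real (n L) / L))"
    proof (intro mult_left_mono)
      have nn: "(1 - b L) * (1 - b L * q L) * N L \<ge> 0" using D.b_less D.bq_less by simp
      have "(1 + (1 - b L) * (1 - b L * q L) * N L) ^ n L \<le> exp ((1 - b L) * (1 - b L * q L) * N L) ^ n L"
        using nn by (intro power_mono exp_ge_add_one_self) auto
      also have "\<dots> = exp ((L * (1 - b L)) * (L * (1 - b L * q L)) * (real (N L) / L) * (real (n L) / L))"
        using elim by (simp flip: exp_of_nat_mult add: mult_ac)
      finally show "(1 + (1 - b L) * (1 - b L * q L) * N L) ^ n L \<le> exp ((L * (1 - b L)) * (L * (1 - b L * q L)) * (real (N L) / L) * (real (n L) / L))" .
    qed (use D.b_less D.bq_less in auto)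
    also have "\<dots> = G L"
    proof -
      have "\<bar>\<bar>1 - q L\<bar> * (1 + 1 / q L) * K L\<bar> = \<bar>q L - 1\<bar> * (1 + 1 / q L) * K L"
        using K0 D.q_pos by (simp add: abs_mult abs_minus_commute)
      then show ?thesis using elim by (simp add: G_def abs_mult)
    qed
    finally show ?case by simp
  qed
  then show ?thesis
    by (intro tendsto_sandwich[OF _ _ tendsto_const G0]) (auto elim: eventually_mono)
qed

text \<open>
  By expansivity the deviation of \<open>H/L\<close> from \<open>h\<close> is controlled by three errors: the shift of \<open>c\<close> from
  \<open>(n - m)/L\<close> to \<open>y - x\<close>, the fluctuation of the observable, and the error of its mean.
\<close>

lemma height_L1_limit:
  assumes h: "0 \<le> h" "h \<le> y" "height_transform qq \<alpha> (y - x) h = (1 + \<alpha>) * Re (J x y)"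
  shows "((\<lambda>L. \<integral>\<eta>. \<bar>real (height (b L) (q L) \<alpha> \<eta> (Suc (m L)) (n L)) / L - h\<bar> \<partial>vertex_noise) \<longlongrightarrow> 0) at_top"
    (is "(?D \<longlongrightarrow> 0) at_top")
proof -
  define k where "k = \<beta>\<^sub>1 - \<beta>\<^sub>2"
  have k: "qq = exp k" "k \<noteq> 0" using \<beta>_neq by (auto simp: k_def qq_def)
  \<comment> \<open>room for \<open>n / L\<close>, which approaches \<open>y\<close> possibly from above\<close>
  define Y where "Y = y + 1"
  define C where "C = \<bar>k\<bar> * exp (- \<bar>k\<bar> * Y)"
  have C: "C > 0" using k by (simp add: C_def)
  define B where "B = (exp (\<bar>k\<bar> * Y) + 1) * (\<alpha> * exp (\<bar>k\<bar> * Y))"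
  let ?\<mu> = "\<lambda>L. dynamic_six_vertex.mean (b L) (q L) \<alpha> (m L) (n L)"
  let ?E = "\<lambda>L. \<integral>\<eta>. \<bar>dynamic_six_vertex.obs (b L) (q L) \<alpha> \<eta> (m L) (n L) - ?\<mu> L\<bar> \<partial>vertex_noise"
  let ?c = "\<lambda>L. (real (n L) - real (m L)) / L"
  define U where "U L = (B * \<bar>qq powr (?c L) - qq powr (y - x)\<bar> + ?E L + \<bar>?\<mu> L - (1 + \<alpha>) * Re (J x y)\<bar>) / C" for L
  have "(U \<longlongrightarrow> (B * \<bar>qq powr (y - x) - qq powr (y - x)\<bar> + 0 + \<bar>(1 + \<alpha>) * Re (J x y) - (1 + \<alpha>) * Re (J x y)\<bar>) / C) at_top"
    unfolding U_def[abs_def] using C k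
    by (intro tendsto_intros lim_c obs_concentration_limit mean_tendsto) auto
  then have U0: "(U \<longlongrightarrow> 0) at_top" by simp
  have "\<forall>\<^sub>F L in at_top. real (n L) / L < Y"
    by (rule order_tendstoD(2)[OF n]) (simp add: Y_def)
  then have "\<forall>\<^sub>F L in at_top. 0 \<le> ?D L \<and> ?D L \<le> U L"
    using eventually_gt_at_top[of 0]
  proof eventually_elim
    case (elim L)
    interpret D: dynamic_six_vertex "b L" "q L" \<alpha> using elim model by blast
    define t where "t \<eta> = real (height (b L) (q L) \<alpha> \<eta> (Suc (m L)) (n L)) / L" for \<eta>
    have t: "0 \<le> t \<eta>" "t \<eta> \<le> Y" for \<eta>
    proof -
      have "t \<eta> \<le> real (n L) / L"
        unfolding t_def using elim height_le by (simp add: divide_right_mono)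
      then show "t \<eta> \<le> Y" using elim by simp
      show "0 \<le> t \<eta>" using elim by (simp add: t_def)
    qed
    have p: "qq powr u \<le> exp (\<bar>k\<bar> * Y)" if "\<bar>u\<bar> \<le> Y" for u
    proof -
      have "k * u \<le> \<bar>k\<bar> * \<bar>u\<bar>" by (metis abs_ge_self abs_mult)
      also have "\<dots> \<le> \<bar>k\<bar> * Y" using that by (intro mult_left_mono) auto
      finally show ?thesis by (simp add: k powr_def mult.commute)
    qed
    have point: "\<bar>t \<eta> - h\<bar> \<le> (B * \<bar>qq powr (?c L) - qq powr (y - x)\<bar> +
        \<bar>D.obs \<eta> (m L) (n L) - ?\<mu> L\<bar> + \<bar>?\<mu> L - (1 + \<alpha>) * Re (J x y)\<bar>) / C" for \<eta>
    proof -
      have "C * \<bar>t \<eta> - h\<bar> \<le> \<bar>height_transform qq \<alpha> (y - x) (t \<eta>) - height_transform qq \<alpha> (y - x) h\<bar>"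
        unfolding C_def using t[of \<eta>] h by (intro height_transform_expansive k \<alpha>) (auto simp: Y_def)
      also have "\<dots> \<le> \<bar>height_transform qq \<alpha> (y - x) (t \<eta>) - height_transform qq \<alpha> (?c L) (t \<eta>)\<bar>
          + \<bar>D.obs \<eta> (m L) (n L) - ?\<mu> L\<bar> + \<bar>?\<mu> L - (1 + \<alpha>) * Re (J x y)\<bar>"
        unfolding h(3) obs_eq_height_transform[OF elim(2)] t_def[symmetric] by linarith
      also have "\<bar>height_transform qq \<alpha> (y - x) (t \<eta>) - height_transform qq \<alpha> (?c L) (t \<eta>)\<bar> \<le> B * \<bar>qq powr (?c L) - qq powr (y - x)\<bar>"
      proof -
        have "height_transform qq \<alpha> (y - x) (t \<eta>) - height_transform qq \<alpha> (?c L) (t \<eta>) =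
           (qq powr t \<eta> - 1) * (\<alpha> * qq powr (- t \<eta>)) * (qq powr (y - x) - qq powr (?c L))"
          unfolding height_transform_def diff_conv_add_uminus[of "y - x" "t \<eta>"] diff_conv_add_uminus[of "?c L" "t \<eta>"] powr_add
          by (simp add: algebra_simps)
        then have "\<bar>height_transform qq \<alpha> (y - x) (t \<eta>) - height_transform qq \<alpha> (?c L) (t \<eta>)\<bar> =
           \<bar>qq powr t \<eta> - 1\<bar> * (\<alpha> * qq powr (- t \<eta>)) * \<bar>qq powr (?c L) - qq powr (y - x)\<bar>"
          using \<alpha> by (simp add: abs_mult abs_minus_commute)
        also have "\<dots> \<le> B * \<bar>qq powr (?c L) - qq powr (y - x)\<bar>"
        proof (intro mult_right_mono)
          have "\<bar>qq powr t \<eta> - 1\<bar> \<le> exp (\<bar>k\<bar> * Y) + 1"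
            using p[of "t \<eta>"] t[of \<eta>] powr_ge_zero[of qq "t \<eta>"] by linarith
          then show "\<bar>qq powr t \<eta> - 1\<bar> * (\<alpha> * qq powr (- t \<eta>)) \<le> B"
            unfolding B_def using p[of "- t \<eta>"] t[of \<eta>] \<alpha> by (intro mult_mono mult_left_mono) auto
        qed simp
        finally show ?thesis .
      qed
      finally show ?thesis using C by (simp add: pos_le_divide_eq mult.commute)
    qed
    have tm: "t \<in> borel_measurable vertex_noise"
      unfolding t_def[abs_def] by (rule measurable_compose[OF measurable_height]) simp
    have "integrable vertex_noise t"
      by (rule vertex_noise.integrable_const_bound[of _ Y]) (use t tm in auto)
    then have "?D L \<le> (\<integral>\<eta>. (B * \<bar>qq powr (?c L) - qq powr (y - x)\<bar> +
        \<bar>D.obs \<eta> (m L) (n L) - ?\<mu> L\<bar> + \<bar>?\<mu> L - (1 + \<alpha>) * Re (J x y)\<bar>) / C \<partial>vertex_noise)"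
      unfolding t_def[symmetric] using D.obs_integrable
      by (intro integral_mono point) auto
    also have "\<dots> = U L"
      unfolding U_def using D.obs_integrable by (simp add: vertex_noise.prob_space)
    finally show ?case by simp
  qed
  then show ?thesis
    by (intro tendsto_sandwich[OF _ _ tendsto_const U0]) (auto elim: eventually_mono)
qed

end

end

section \<open>Real arguments and convergence in probability\<close>

lemma height_borel_measurable [measurable]:
  "(\<lambda>\<eta>. real (height b q \<alpha> \<eta> x y)) \<in> borel_measurable vertex_noise"
  by (rule measurable_compose[OF measurable_height]) simp

lemma height_integrable: "integrable vertex_noise (\<lambda>\<eta>. real (height b q \<alpha> \<eta> x y))"
  by (rule vertex_noise.integrable_const_bound[of _ "real y"]) (auto simp: height_le)

lemma abs_convex_combination_le:
  fixes u v f :: real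
  assumes "0 \<le> f" "f \<le> 1"
  shows "\<bar>(1 - f) * u + f * v\<bar> \<le> \<bar>u\<bar> + \<bar>v\<bar>"
proof -
  have "\<bar>(1 - f) * u\<bar> \<le> \<bar>u\<bar>" "\<bar>f * v\<bar> \<le> \<bar>v\<bar>"
    using assms by (auto simp: abs_mult intro!: mult_left_le_one_le)
  then show ?thesis by linarith
qed

lemma height_interp_deviation_le:
  assumes "X \<ge> 0" "Y \<ge> 0" "L > 0"
  shows "\<bar>height_interp b q \<alpha> \<eta> X Y / L - h\<bar> \<le>
    (\<bar>real (height b q \<alpha> \<eta> (nat \<lfloor>X\<rfloor>) (nat \<lfloor>Y\<rfloor>)) / L - h\<bar> + \<bar>real (height b q \<alpha> \<eta> (Suc (nat \<lfloor>X\<rfloor>)) (nat \<lfloor>Y\<rfloor>)) / L - h\<bar>)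
    + (\<bar>real (height b q \<alpha> \<eta> (nat \<lfloor>X\<rfloor>) (Suc (nat \<lfloor>Y\<rfloor>))) / L - h\<bar> + \<bar>real (height b q \<alpha> \<eta> (Suc (nat \<lfloor>X\<rfloor>)) (Suc (nat \<lfloor>Y\<rfloor>))) / L - h\<bar>)"
    (is "_ \<le> (\<bar>?a / L - h\<bar> + \<bar>?b / L - h\<bar>) + (\<bar>?c / L - h\<bar> + \<bar>?d / L - h\<bar>)")
proof -
  let ?f = "frac X" and ?g = "frac Y"
  have f: "0 \<le> ?f" "?f \<le> 1" "0 \<le> ?g" "?g \<le> 1"
    using frac_lt_1[of X] frac_lt_1[of Y] by auto
  have "height_interp b q \<alpha> \<eta> X Y / L - h =
    (1 - ?g) * ((1 - ?f) * (?a / L - h) + ?f * (?b / L - h)) + ?g * ((1 - ?f) * (?c / L - h) + ?f * (?d / L - h))"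
    unfolding height_interp_def height_interp_x_def using assms by (simp add: field_simps)
  also have "\<bar>\<dots>\<bar> \<le> \<bar>(1 - ?f) * (?a / L - h) + ?f * (?b / L - h)\<bar> + \<bar>(1 - ?f) * (?c / L - h) + ?f * (?d / L - h)\<bar>"
    by (rule abs_convex_combination_le) (use f in auto)
  also have "\<dots> \<le> (\<bar>?a / L - h\<bar> + \<bar>?b / L - h\<bar>) + (\<bar>?c / L - h\<bar> + \<bar>?d / L - h\<bar>)"
    by (intro add_mono abs_convex_combination_le f)
  finally show ?thesis .
qed

lemma scaled_limit_of_bounded_difference:
  fixes m :: "real \<Rightarrow> nat"
  assumes "\<forall>\<^sub>F L in at_top. \<bar>real (m L) - L * x\<bar> \<le> C"
  shows "((\<lambda>L. real (m L) / L) \<longlongrightarrow> x) at_top"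
proof (rule LIM_zero_cancel, rule Lim_null_comparison)
  show "\<forall>\<^sub>F L in at_top. norm (real (m L) / L - x) \<le> C / L"
    using assms eventually_gt_at_top[of 0]
  proof eventually_elim
    case (elim L)
    have "real (m L) / L - x = (real (m L) - L * x) / L" using elim by (simp add: field_simps)
    then show ?case using elim by (simp add: divide_right_mono)
  qed
  show "((\<lambda>L. C / L) \<longlongrightarrow> 0) at_top" by real_asymp
qed

text \<open>
  The three lattice sequences that occur in the interpolation. The predecessor appears since the
  index \<open>m\<close> of a lattice point is its first coordinate minus one.
\<close>

lemma scaled_floor_limits:
  fixes x :: real
  assumes "x > 0"
  shows "((\<lambda>L. real (nat \<lfloor>L * x\<rfloor>) / L) \<longlongrightarrow> x) at_top"
    "((\<lambda>L. real (nat \<lfloor>L * x\<rfloor> - 1) / L) \<longlongrightarrow> x) at_top"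
    "((\<lambda>L. real (Suc (nat \<lfloor>L * x\<rfloor>)) / L) \<longlongrightarrow> x) at_top"
proof -
  have "\<forall>\<^sub>F L in at_top. \<bar>real (nat \<lfloor>L * x\<rfloor>) - L * x\<bar> \<le> 1 \<and> \<bar>real (nat \<lfloor>L * x\<rfloor> - 1) - L * x\<bar> \<le> 2
     \<and> \<bar>real (Suc (nat \<lfloor>L * x\<rfloor>)) - L * x\<bar> \<le> 2"
    using eventually_gt_at_top[of 0]
  proof eventually_elim
    case (elim L)
    then have "0 \<le> L * x" using assms by simp
    then have "real (nat \<lfloor>L * x\<rfloor>) = of_int \<lfloor>L * x\<rfloor>" by simp
    then have "\<bar>real (nat \<lfloor>L * x\<rfloor>) - L * x\<bar> \<le> 1" by linarith
    moreover have "\<bar>real (nat \<lfloor>L * x\<rfloor> - 1) - real (nat \<lfloor>L * x\<rfloor>)\<bar> \<le> 1" by linarith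
    ultimately show ?case by auto
  qed
  then show "((\<lambda>L. real (nat \<lfloor>L * x\<rfloor>) / L) \<longlongrightarrow> x) at_top"
    "((\<lambda>L. real (nat \<lfloor>L * x\<rfloor> - 1) / L) \<longlongrightarrow> x) at_top"
    "((\<lambda>L. real (Suc (nat \<lfloor>L * x\<rfloor>)) / L) \<longlongrightarrow> x) at_top"
    by (auto intro!: scaled_limit_of_bounded_difference elim: eventually_mono simp del: of_nat_Suc One_nat_def)
qed

lemma tendsto_in_prob_of_L1:
  assumes "prob_space M" "\<forall>\<^sub>F i in F. integrable M (X i)"
    and lim: "((\<lambda>i. \<integral>\<eta>. \<bar>X i \<eta> - c\<bar> \<partial>M) \<longlongrightarrow> 0) F"
  shows "tendsto_in_prob M X c F"
  unfolding tendsto_in_prob_def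
proof (intro conjI allI impI)
  interpret prob_space M by fact
  show "\<forall>\<^sub>F i in F. X i \<in> borel_measurable M" using assms(2) by (auto elim: eventually_mono)
  fix \<epsilon> :: real assume \<epsilon>: "\<epsilon> > 0"
  have "\<forall>\<^sub>F i in F. measure M {\<omega> \<in> space M. \<bar>X i \<omega> - c\<bar> > \<epsilon>} \<le> (\<integral>\<eta>. \<bar>X i \<eta> - c\<bar> \<partial>M) / \<epsilon>"
    using assms(2)
  proof eventually_elim
    case (elim i)
    then have [measurable]: "X i \<in> borel_measurable M" by auto
    have "measure M {\<omega> \<in> space M. \<bar>X i \<omega> - c\<bar> > \<epsilon>} \<le> measure M {\<omega> \<in> space M. \<bar>X i \<omega> - c\<bar> \<ge> \<epsilon>}"
      by (rule finite_measure_mono) auto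
    also have "\<dots> \<le> (\<integral>\<eta>. \<bar>X i \<eta> - c\<bar> \<partial>M) / \<epsilon>"
      by (rule integral_Markov_inequality_measure[where A = "{}"]) (use elim \<epsilon> in auto)
    finally show ?case .
  qed
  then show "((\<lambda>i. measure M {\<omega> \<in> space M. \<bar>X i \<omega> - c\<bar> > \<epsilon>}) \<longlongrightarrow> 0) F"
    by (intro tendsto_sandwich[OF _ _ tendsto_const tendsto_divide[OF lim tendsto_const, of \<epsilon>, simplified]])
       (use \<epsilon> in auto)
qed

context weak_asymmetry
begin

lemma height_interp_L1_limit:
  assumes x: "x > 0" and y: "y > 0" and h: "0 \<le> h" "h \<le> y" "height_transform qq \<alpha> (y - x) h = (1 + \<alpha>) * Re (J x y)"
  shows "((\<lambda>L. \<integral>\<eta>. \<bar>height_interp (b L) (q L) \<alpha> \<eta> (L * x) (L * y) / L - h\<bar> \<partial>vertex_noise) \<longlongrightarrow> 0) at_top"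
proof -
  define E where "E i j L = (\<integral>\<eta>. \<bar>real (height (b L) (q L) \<alpha> \<eta> i j) / L - h\<bar> \<partial>vertex_noise)" for i j L
  define X where "X L = nat \<lfloor>L * x\<rfloor>" for L
  define Y where "Y L = nat \<lfloor>L * y\<rfloor>" for L
  note fl = scaled_floor_limits[OF x, folded X_def] scaled_floor_limits[OF y, folded Y_def]
  have lim: "((\<lambda>L. E (Suc (m L)) (n L) L) \<longlongrightarrow> 0) at_top"
    if "((\<lambda>L. real (m L) / L) \<longlongrightarrow> x) at_top" "((\<lambda>L. real (n L) / L) \<longlongrightarrow> y) at_top" for m n
    unfolding E_def by (rule height_L1_limit[OF x y that h])
  define S where "S L = (E (Suc (X L - 1)) (Y L) L + E (Suc (X L)) (Y L) L)
     + (E (Suc (X L - 1)) (Suc (Y L)) L + E (Suc (X L)) (Suc (Y L)) L)" for L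
  have "(S \<longlongrightarrow> (0 + 0) + (0 + 0)) at_top"
    unfolding S_def[abs_def] by (intro tendsto_add lim fl)
  then have S: "(S \<longlongrightarrow> 0) at_top" by simp
  have "\<forall>\<^sub>F L in at_top. (\<integral>\<eta>. \<bar>height_interp (b L) (q L) \<alpha> \<eta> (L * x) (L * y) / L - h\<bar> \<partial>vertex_noise) \<le> S L"
    using eventually_ge_at_top[of "1 / x"]
  proof eventually_elim
    case (elim L)
    then have L: "L > 0" using x by (metis divide_pos_pos less_le_trans zero_less_one)
    have "L * x \<ge> 1" using elim x by (simp add: field_simps)
    then have X1: "Suc (X L - 1) = nat \<lfloor>L * x\<rfloor>" unfolding X_def by linarith
    have nn: "0 \<le> L * x" "0 \<le> L * y" using L x y by auto
    note int = height_integrable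
    have "(\<integral>\<eta>. \<bar>height_interp (b L) (q L) \<alpha> \<eta> (L * x) (L * y) / L - h\<bar> \<partial>vertex_noise) \<le>
      (\<integral>\<eta>. (\<bar>real (height (b L) (q L) \<alpha> \<eta> (Suc (X L - 1)) (Y L)) / L - h\<bar> + \<bar>real (height (b L) (q L) \<alpha> \<eta> (Suc (X L)) (Y L)) / L - h\<bar>)
    + (\<bar>real (height (b L) (q L) \<alpha> \<eta> (Suc (X L - 1)) (Suc (Y L))) / L - h\<bar> + \<bar>real (height (b L) (q L) \<alpha> \<eta> (Suc (X L)) (Suc (Y L))) / L - h\<bar>) \<partial>vertex_noise)"
    proof (rule integral_mono)
      show "integrable vertex_noise (\<lambda>\<eta>. \<bar>height_interp (b L) (q L) \<alpha> \<eta> (L * x) (L * y) / L - h\<bar>)"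
        unfolding height_interp_def height_interp_x_def using int by simp
    qed (use int in simp, unfold X1, unfold X_def Y_def, rule height_interp_deviation_le[OF nn L])
    also have "\<dots> = S L" unfolding S_def E_def using int by simp
    finally show ?case .
  qed
  then show ?thesis
    by (intro tendsto_sandwich[OF _ _ tendsto_const S]) auto
qed

lemma hydrodynamic_limit:
  assumes x: "x > 0" and y: "y > 0"
  shows "\<exists>h. (\<forall>\<gamma>. admissible_contour s \<gamma> \<longrightarrow>
      (\<forall>r. of_real (limit_lhs qq \<alpha> x y r) = limit_rhs \<gamma> qq s x y \<longleftrightarrow> r = h)) \<and>
    tendsto_in_prob vertex_noise (\<lambda>L \<eta>. height_interp (b L) (q L) \<alpha> \<eta> (L * x) (L * y) / L) h at_top"
proof -
  note fl = scaled_floor_limits(1)[OF x] scaled_floor_limits(1)[OF y]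
  obtain h where h: "0 \<le> h" "h \<le> y" "height_transform qq \<alpha> (y - x) h = (1 + \<alpha>) * Re (J x y)"
    using limit_height_exists[OF x y fl] by blast
  have J: "J x y = of_real (Re (J x y))" by (rule J_real[OF x y fl])
  have qq: "qq > 0" by (simp add: qq_def)
  show ?thesis
  proof (intro exI[of _ h] conjI allI impI)
    fix \<gamma> r assume "admissible_contour s \<gamma>"
    then have "of_real (limit_lhs qq \<alpha> x y r) = limit_rhs \<gamma> qq s x y \<longleftrightarrow> limit_lhs qq \<alpha> x y r = Re (J x y)"
      by (subst limit_rhs_eq_J, assumption, subst J) (simp only: of_real_eq_iff)
    also have "\<dots> \<longleftrightarrow> height_transform qq \<alpha> (y - x) r = height_transform qq \<alpha> (y - x) h"
      unfolding limit_lhs_height_transform[OF \<alpha> qq] h(3) using \<alpha> by (simp add: field_simps)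
    also have "\<dots> \<longleftrightarrow> r = h"
      using height_transform_inj[OF qq_def _ \<alpha>] \<beta>_neq by auto
    finally show "of_real (limit_lhs qq \<alpha> x y r) = limit_rhs \<gamma> qq s x y \<longleftrightarrow> r = h" .
  next
    show "tendsto_in_prob vertex_noise (\<lambda>L \<eta>. height_interp (b L) (q L) \<alpha> \<eta> (L * x) (L * y) / L) h at_top"
    proof (rule tendsto_in_prob_of_L1[OF vertex_noise.prob_space_axioms _ height_interp_L1_limit[OF x y h]])
      show "\<forall>\<^sub>F L in at_top. integrable vertex_noise (\<lambda>\<eta>. height_interp (b L) (q L) \<alpha> \<eta> (L * x) (L * y) / L)"
        unfolding height_interp_def height_interp_x_def using height_integrable by simp
    qed
  qed
qed

end

lemma tendsto_in_prob_cong: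
  assumes "\<forall>\<^sub>F i in F. X i = X' i"
  shows "tendsto_in_prob M X c F \<longleftrightarrow> tendsto_in_prob M X' c F"
proof -
  have "(\<forall>\<^sub>F i in F. X i \<in> borel_measurable M) \<longleftrightarrow> (\<forall>\<^sub>F i in F. X' i \<in> borel_measurable M)"
    by (rule eventually_cong[OF assms]) simp
  moreover have "((\<lambda>i. measure M {\<omega> \<in> space M. \<bar>X i \<omega> - c\<bar> > \<epsilon>}) \<longlongrightarrow> 0) F \<longleftrightarrow>
      ((\<lambda>i. measure M {\<omega> \<in> space M. \<bar>X' i \<omega> - c\<bar> > \<epsilon>}) \<longlongrightarrow> 0) F" for \<epsilon>
    by (rule filterlim_cong[OF refl refl]) (use assms in \<open>auto elim: eventually_mono\<close>)
  ultimately show ?thesis by (simp add: tendsto_in_prob_def)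
qed

theorem theorem2p1:
  fixes \<alpha> \<beta>\<^sub>1 \<beta>\<^sub>2 qq s :: real and b q :: "real \<Rightarrow> real"
  assumes "\<alpha> \<ge> 0" and "\<beta>\<^sub>1 > 0" and "\<beta>\<^sub>2 > 0" and "\<beta>\<^sub>1 \<noteq> \<beta>\<^sub>2"
    and b: "\<forall>\<^sub>F L in at_top. b L = exp (- \<beta>\<^sub>1 / L)"
    and q: "\<forall>\<^sub>F L in at_top. q L * b L = exp (- \<beta>\<^sub>2 / L)"
    and qq: "qq = exp (\<beta>\<^sub>1 - \<beta>\<^sub>2)"
    and s: "s = \<beta>\<^sub>1 / \<beta>\<^sub>2"
  shows "\<exists>h :: real \<Rightarrow> real \<Rightarrow> real. \<forall>x>0. \<forall>y>0.
           (\<forall>\<gamma>. admissible_contour s \<gamma> \<longrightarrow>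
             (\<forall>r. of_real (limit_lhs qq \<alpha> x y r) = limit_rhs \<gamma> qq s x y \<longleftrightarrow> r = h x y)) \<and>
           tendsto_in_prob vertex_noise
             (\<lambda>L \<omega>. height_interp (b L) (q L) \<alpha> \<omega> (L * x) (L * y) / L) (h x y) at_top"
proof -
  interpret W: weak_asymmetry \<beta>\<^sub>1 \<beta>\<^sub>2 \<alpha> by unfold_locales fact+
  have parameters: "\<forall>\<^sub>F L in at_top. W.b L = b L \<and> W.q L = q L"
    using b q
  proof eventually_elim
    case (elim L)
    then have "q L * W.b L = W.q L * W.b L" using W.bq[of L] by (simp add: W.b_def mult.commute)
    then show ?case using elim by (simp add: W.b_def)
  qed
  define P where "P x y h \<longleftrightarrow> (\<forall>\<gamma>. admissible_contour s \<gamma> \<longrightarrow>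
             (\<forall>r. of_real (limit_lhs qq \<alpha> x y r) = limit_rhs \<gamma> qq s x y \<longleftrightarrow> r = h)) \<and>
           tendsto_in_prob vertex_noise
             (\<lambda>L \<omega>. height_interp (b L) (q L) \<alpha> \<omega> (L * x) (L * y) / L) h at_top" for x y h
  have "\<exists>h. P x y h"
    if xy: "x > 0" "y > 0" for x y
  proof -
    have "tendsto_in_prob vertex_noise (\<lambda>L \<omega>. height_interp (b L) (q L) \<alpha> \<omega> (L * x) (L * y) / L) h at_top
      \<longleftrightarrow> tendsto_in_prob vertex_noise (\<lambda>L \<omega>. height_interp (W.b L) (W.q L) \<alpha> \<omega> (L * x) (L * y) / L) h at_top" for h
      by (rule tendsto_in_prob_cong) (use parameters in \<open>auto elim: eventually_mono\<close>)
    moreover have "qq = W.qq" "s = W.s" by (simp_all add: qq s W.qq_def W.s_def)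
    ultimately show ?thesis using W.hydrodynamic_limit[OF xy] unfolding P_def by (simp only:)
  qed
  then obtain h where "P x y (h x y)" if "x > 0" "y > 0" for x y by metis
  then show ?thesis unfolding P_def by blast
qed

end
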